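(* Let $\Omega_0\subset\mathbb{R}^2$ be a non-empty open convex set that does not contain lines, let $\Omega_1\subset\mathbb{R}^2$ be an open convex set with $\mathrm{cl}\,\Omega_1\subset\Omega_0$, and let $\Omega=\mathrm{cl}(\Omega_0\setminus\Omega_1)$. Suppose that neither $\partial\Omega_0$ nor $\partial\Omega_1$ contains linear segments, that $\Omega_0$ is unbounded, and that every ray contained in $\Omega_0$ can be translated so as to belong to $\Omega_1$ entirely. If $\varphi\in\boldsymbol{A}_\Omega$, then its non-decreasing rearrangement $\varphi^*$ also belongs to $\boldsymbol{A}_\Omega$.
   Context: $\mathrm{cl}$ denotes closure. Fix an interval $I\subset\mathbb{R}$; for a subinterval $J\subset I$ put $\langle\varphi\rangle_J=\frac1{|J|}\int_J\varphi(s)\,ds$. Define $$\boldsymbol{A}_\Omega=\{\varphi\in L^1(I,\mathbb{R}^2):\ \varphi(I)\subset\partial\Omega_0,\ \langle\varphi\rangle_J\notin\Omega_1\text{ for every subinterval }J\subset I\}.$$ Fix an oriented line $\ell$ in the plane such that the orthogonal projection onto $\ell$ is injective on $\partial\Omega_0$ (so its inverse parametrizes $\partial\Omega_0$). A function $\varphi\colon I\to\partial\Omega_0$ is called monotone (non-decreasing, non-increasing) if its composition with this projection is. Two functions are equimeasurable if they have the same distribution (image of normalized Lebesgue measure). For a measurable $\varphi\colon I\to\partial\Omega_0$, its non-decreasing rearrangement $\varphi^*\colon I\to\partial\Omega_0$ is the (unique up to null sets) non-decreasing function equimeasurable with $\varphi$. *)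

theory Defs
  imports "HOL-Analysis.Analysis"
begin

definition line :: "real^2 \<Rightarrow> real^2 \<Rightarrow> (real^2) set" where
  "line x d = {x + t *\<^sub>R d | t. True}"

definition ray :: "real^2 \<Rightarrow> real^2 \<Rightarrow> (real^2) set" where
  "ray x d = {x + t *\<^sub>R d | t. t \<ge> 0}"

definition contains_line :: "(real^2) set \<Rightarrow> bool" where
  "contains_line S \<longleftrightarrow> (\<exists>x d. d \<noteq> 0 \<and> line x d \<subseteq> S)"

definition contains_segment :: "(real^2) set \<Rightarrow> bool" where
  "contains_segment S \<longleftrightarrow> (\<exists>x y. x \<noteq> y \<and> closed_segment x y \<subseteq> S)"

text \<open>Intervals may be open, closed or half-open, but they are bounded and of positive length,
  so that averages over them make sense.\<close>

definition bounded_interval :: "real set \<Rightarrow> bool" where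
  "bounded_interval J \<longleftrightarrow> is_interval J \<and> bounded J \<and> interior J \<noteq> {}"

definition average :: "real set \<Rightarrow> (real \<Rightarrow> real^2) \<Rightarrow> real^2" where
  "average J \<phi> = (1 / measure lebesgue J) *\<^sub>R (LINT s:J|lebesgue. \<phi> s)"

text \<open>The class usually written with the single index \<open>cl (\<Omega>0 \ \<Omega>1)\<close>; its definition refers to
  \<open>\<Omega>0\<close> and \<open>\<Omega>1\<close> only. A function on \<open>I\<close> is a function on the reals whose values outside \<open>I\<close>
  are irrelevant.\<close>

definition A_class :: "real set \<Rightarrow> (real^2) set \<Rightarrow> (real^2) set \<Rightarrow> (real \<Rightarrow> real^2) set" where
  "A_class I \<Omega>0 \<Omega>1 =
    {\<phi>. \<phi> absolutely_integrable_on I \<and> \<phi> ` I \<subseteq> frontier \<Omega>0 \<and>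
        (\<forall>J. bounded_interval J \<and> J \<subseteq> I \<longrightarrow> average J \<phi> \<notin> \<Omega>1)}"

text \<open>The oriented line through \<open>p\<close> with unit direction \<open>u\<close> is identified with the reals by
  \<open>t \<mapsto> p + t u\<close>; under this identification \<open>proj_line p u\<close> is the orthogonal projection onto it.\<close>

definition proj_line :: "real^2 \<Rightarrow> real^2 \<Rightarrow> real^2 \<Rightarrow> real" where
  "proj_line p u x = (x - p) \<bullet> u"

definition nondecreasing_on :: "real^2 \<Rightarrow> real^2 \<Rightarrow> real set \<Rightarrow> (real \<Rightarrow> real^2) \<Rightarrow> bool" where
  "nondecreasing_on p u S \<psi> \<longleftrightarrow> mono_on S (proj_line p u \<circ> \<psi>)"

definition equimeasurable :: "real set \<Rightarrow> (real \<Rightarrow> real^2) \<Rightarrow> (real \<Rightarrow> real^2) \<Rightarrow> bool" where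
  "equimeasurable I \<phi> \<psi> \<longleftrightarrow>
    \<phi> \<in> borel_measurable (lebesgue_on I) \<and> \<psi> \<in> borel_measurable (lebesgue_on I) \<and>
    distr (uniform_measure (lebesgue_on I) I) borel \<phi> =
      distr (uniform_measure (lebesgue_on I) I) borel \<psi>"

text \<open>Rearrangements are determined up to null sets, so monotonicity is required off a null set.
  Requiring it at every point of \<open>I\<close> would be too much: if \<open>I\<close> contains its right endpoint, a
  function that is non-decreasing on all of \<open>I\<close> has projection bounded above, whereas
  \<open>\<phi>\<close> may be unbounded.\<close>

definition nondecreasing_rearrangement ::
    "real set \<Rightarrow> (real^2) set \<Rightarrow> real^2 \<Rightarrow> real^2 \<Rightarrow> (real \<Rightarrow> real^2) \<Rightarrow> (real \<Rightarrow> real^2) \<Rightarrow> bool" where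
  "nondecreasing_rearrangement I \<Omega>0 p u \<phi> \<psi> \<longleftrightarrow>
    \<psi> ` I \<subseteq> frontier \<Omega>0 \<and> equimeasurable I \<phi> \<psi> \<and>
    (\<exists>N \<in> null_sets lebesgue. nondecreasing_on p u (I - N) \<psi>)"

end

theory Submission
  imports Defs "HOL-Probability.Probability"
begin

text \<open>Injectivity of the projection forces a direction \<open>e\<close> orthogonal to \<open>u\<close> in which \<open>\<Omega>0\<close>, and
  hence \<open>\<Omega>1\<close>, is closed under translation: in the coordinates \<open>(w \<bullet> u, w \<bullet> e)\<close> the frontier of
  \<open>\<Omega>0\<close> is the graph of a convex function. Suppose the average \<open>z\<close> of the rearrangement \<open>\<psi>\<close> over
  \<open>J\<close> lies in \<open>\<Omega>1\<close>, and put \<open>\<alpha> = z \<bullet> u\<close>. Replacing \<open>u\<close> by \<open>- u\<close> if necessary, the mean of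
  \<open>\<phi> \<bullet> u\<close> over \<open>I\<close> is at most \<open>\<alpha>\<close>. As in Klemes' proof for BMO, the rising sun lemma gives an open
  set \<open>U\<close>, a disjoint union of intervals on which \<open>\<phi> \<bullet> u\<close> has mean exactly \<open>\<alpha>\<close>, such that
  \<open>\<phi> \<bullet> u \<le> \<alpha>\<close> almost everywhere off \<open>U\<close>. Since \<open>\<psi>\<close> takes on \<open>J\<close> a full window of the values of
  \<open>\<phi>\<close>, comparing the convex function with a chord shows that the average of \<open>\<phi>\<close> over \<open>U\<close> lies
  above \<open>z\<close>. The same then holds up to an arbitrarily small error on one of the intervals
  forming \<open>U\<close>, so the average of \<open>\<phi>\<close> over that interval is in \<open>\<Omega>1\<close>, a contradiction.\<close>

section \<open>Convex sets with injective projection of the frontier\<close>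

text \<open>Openness lets \<open>x\<close> move slightly away from \<open>v\<close> without leaving
  \<open>S\<close>. The target is a convex combination of that shifted point and a far point of the
  ray from \<open>v\<close>; the displacement along \<open>x - v\<close> cancels.\<close>

lemma open_convex_add_recession:
  fixes S :: "'a::real_normed_vector set"
  assumes S: "open S" "convex S" and ray: "\<And>t. t \<ge> 0 \<Longrightarrow> v + t *\<^sub>R e \<in> S"
    and x: "x \<in> S" and t: "t \<ge> 0"
  shows "x + t *\<^sub>R e \<in> S"
proof -
  have "((\<lambda>\<epsilon>. x + \<epsilon> *\<^sub>R (x - v)) \<longlongrightarrow> x + 0 *\<^sub>R (x - v)) (at_right 0)"
    by (intro tendsto_intros)
  then have "\<forall>\<^sub>F \<epsilon> in at_right 0. x + \<epsilon> *\<^sub>R (x - v) \<in> S"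
    using S(1) x by (auto dest: topological_tendstoD)
  then have "\<forall>\<^sub>F \<epsilon>::real in at_right 0. x + \<epsilon> *\<^sub>R (x - v) \<in> S \<and> \<epsilon> > 0"
    by (intro eventually_conj) (auto simp: eventually_at_right_less)
  then obtain \<epsilon> :: real where e: "x + \<epsilon> *\<^sub>R (x - v) \<in> S" "\<epsilon> > 0"
    using eventually_happens'[OF trivial_limit_at_right_real] by blast
  \<comment> \<open>The ray point will carry weight \<open>\<epsilon> / (1 + \<epsilon>)\<close>, so
    \<open>?T\<close> is \<open>t\<close> divided by that weight.\<close>
  let ?T = "t * (1 + \<epsilon>) / \<epsilon>"
  have T: "?T \<ge> 0" using t e by auto
  have "(1 / (1 + \<epsilon>)) *\<^sub>R (x + \<epsilon> *\<^sub>R (x - v)) + (\<epsilon> / (1 + \<epsilon>)) *\<^sub>R (v + ?T *\<^sub>R e) \<in> S"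
    using e T by (intro convexD[OF S(2)] ray) (auto simp: field_simps)
  also have "(1 / (1 + \<epsilon>)) *\<^sub>R (x + \<epsilon> *\<^sub>R (x - v)) + (\<epsilon> / (1 + \<epsilon>)) *\<^sub>R (v + ?T *\<^sub>R e)
      = (1 / (1 + \<epsilon>) + \<epsilon> / (1 + \<epsilon>)) *\<^sub>R x + ((\<epsilon> / (1 + \<epsilon>)) * ?T) *\<^sub>R e"
    by (simp only: scaleR_add_left scaleR_add_right scaleR_diff_right scaleR_scaleR) simp
  also have "1 / (1 + \<epsilon>) + \<epsilon> / (1 + \<epsilon>) = 1" using e by (simp add: field_simps)
  also have "(\<epsilon> / (1 + \<epsilon>)) * ?T = t"
  proof -
    have "1 + \<epsilon> \<noteq> 0" "\<epsilon> \<noteq> 0" using e by auto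
    then show ?thesis by simp
  qed
  also have "1 *\<^sub>R x + t *\<^sub>R e = x + t *\<^sub>R e" by simp
  finally show ?thesis .
qed

lemma frontier_crossing:
  fixes x :: "'a::real_normed_vector"
  assumes "open S" "x \<in> S" "x + s *\<^sub>R e \<notin> S" "s \<ge> 0"
  obtains t where "t > 0" "t \<le> s" "x + t *\<^sub>R e \<in> frontier S"
proof -
  let ?L = "(\<lambda>t. x + t *\<^sub>R e) ` {0..s}"
  have "connected ?L"
    by (intro connected_continuous_image continuous_intros) auto
  moreover have "x \<in> ?L" using assms(4) by (intro image_eqI[of _ _ 0]) auto
  then have "?L \<inter> S \<noteq> {}" using assms(2) by blast
  moreover have "x + s *\<^sub>R e \<in> ?L" using assms(4) by (intro imageI) auto
  then have "?L - S \<noteq> {}" using assms(3) by blast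
  ultimately have "?L \<inter> frontier S \<noteq> {}" by (rule connected_Int_frontier)
  then obtain t where t: "0 \<le> t" "t \<le> s" "x + t *\<^sub>R e \<in> frontier S" by auto
  moreover have "t \<noteq> 0" using t assms by (auto simp: frontier_def interior_open)
  ultimately show thesis using that[of t] by simp
qed

text \<open>A line in direction \<open>e0\<close> has a single projection, so by injectivity it
  meets the frontier at most once. It is not contained in \<Omega>0, so from a point of \<Omega>0 it
  leaves on one side and stays inside on the other. The side found at one point serves for all,
  since recession directions of an open convex set do not depend on the starting point.\<close>

lemma epigraph_direction:
  fixes \<Omega>0 :: "'a::euclidean_space set"
  assumes ne: "\<Omega>0 \<noteq> {}" and op: "open \<Omega>0" and cv: "convex \<Omega>0"
    and nl: "\<And>x. \<exists>t. x + t *\<^sub>R e0 \<notin> \<Omega>0"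
    and inj: "inj_on (\<lambda>w. w \<bullet> u) (frontier \<Omega>0)" and e0u: "e0 \<bullet> u = 0"
  obtains e where "e = e0 \<or> e = - e0" "\<And>z t. z \<in> \<Omega>0 \<Longrightarrow> t \<ge> 0 \<Longrightarrow> z + t *\<^sub>R e \<in> \<Omega>0"
    "\<And>z. z \<in> \<Omega>0 \<Longrightarrow> \<exists>t>0. z - t *\<^sub>R e \<in> frontier \<Omega>0"
proof -
  obtain z0 where z0: "z0 \<in> \<Omega>0" using ne by blast
  obtain s where s: "z0 + s *\<^sub>R e0 \<notin> \<Omega>0" using nl by blast
  \<comment> \<open>The sign is chosen so that the exit found with \<open>s\<close> lies in
    direction \<open>- e\<close>.\<close>
  define e where "e = (if s \<ge> 0 then - e0 else e0)"
  have e: "e = e0 \<or> e = - e0" and eu: "e \<bullet> u = 0" using e0u by (auto simp: e_def)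
  have s': "z0 + \<bar>s\<bar> *\<^sub>R (- e) \<notin> \<Omega>0" using s by (auto simp: e_def)
  obtain \<tau> where \<tau>: "\<tau> > 0" "z0 + \<tau> *\<^sub>R (-e) \<in> frontier \<Omega>0"
    using frontier_crossing[OF op z0 s'] by auto
  have "z0 + t *\<^sub>R e \<in> \<Omega>0" if t: "t \<ge> 0" for t
  proof (rule ccontr)
    assume "z0 + t *\<^sub>R e \<notin> \<Omega>0"
    then obtain t' where t': "t' > 0" "z0 + t' *\<^sub>R e \<in> frontier \<Omega>0"
      using frontier_crossing[OF op z0 _ t] by auto
    have "z0 + t' *\<^sub>R e = z0 + \<tau> *\<^sub>R (-e)"
      using eu by (intro inj_onD[OF inj _ t'(2) \<tau>(2)]) (simp add: inner_add_left inner_diff_left)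
    then have "(t' + \<tau>) *\<^sub>R e = 0" by (simp add: scaleR_add_left)
    then have "e = 0" using t' \<tau> by auto
    then show False using s' z0 by simp
  qed
  note up = open_convex_add_recession[OF op cv this]
  have "\<exists>t>0. z - t *\<^sub>R e \<in> frontier \<Omega>0" if z: "z \<in> \<Omega>0" for z
  proof -
    obtain r where "z + r *\<^sub>R e0 \<notin> \<Omega>0" using nl by blast
    then have "z + (if e = e0 then r else - r) *\<^sub>R e \<notin> \<Omega>0" using e by auto
    then obtain r' where r': "z + r' *\<^sub>R e \<notin> \<Omega>0" by blast
    then have "\<not> r' \<ge> 0" using up[OF _ z] by blast
    then have "- r' \<ge> 0" "z + (- r') *\<^sub>R (- e) \<notin> \<Omega>0" using r' by auto
    then obtain t where t: "t > 0" "z + t *\<^sub>R (- e) \<in> frontier \<Omega>0"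
      using frontier_crossing[OF op z, of "- r'" "- e"] by auto
    then show ?thesis by (intro exI[of _ t]) simp
  qed
  then show thesis using that[OF e up] by simp
qed

text \<open>The residual \<open>r\<close> is orthogonal to both \<open>u\<close> and
  \<open>e\<close>. These are two linear equations with nonzero determinant \<open>D\<close>, so
  \<open>r = 0\<close> by Cramer's rule.\<close>

lemma plane_decomp:
  fixes w u e :: "real^2"
  assumes "norm u = 1" "norm e = 1" "e \<bullet> u = 0"
  shows "w = (w \<bullet> u) *\<^sub>R u + (w \<bullet> e) *\<^sub>R e"
proof -
  define r where "r = w - ((w \<bullet> u) *\<^sub>R u + (w \<bullet> e) *\<^sub>R e)"
  have uu: "u \<bullet> u = 1" and ee: "e \<bullet> e = 1" using assms by (auto simp: norm_eq_1)
  have "r \<bullet> u = 0" "r \<bullet> e = 0"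
    using uu ee assms(3) by (simp_all add: r_def inner_diff_left inner_add_left inner_commute[of u e])
  then have ru: "r$1 * u$1 + r$2 * u$2 = 0" and re: "r$1 * e$1 + r$2 * e$2 = 0"
    by (simp_all add: inner_vec_def sum_2)
  define D where "D = u$1 * e$2 - u$2 * e$1"
  \<comment> \<open>Lagrange's identity; with the present \<open>u\<close> and \<open>e\<close> the
    right-hand side is 1.\<close>
  have "D\<^sup>2 + (e \<bullet> u)\<^sup>2 = (u \<bullet> u) * (e \<bullet> e)"
    by (simp add: D_def inner_vec_def sum_2 power2_eq_square algebra_simps)
  then have "D \<noteq> 0" using uu ee assms(3) by auto
  have 1: "r$1 * D = (r$1 * u$1 + r$2 * u$2) * e$2 - (r$1 * e$1 + r$2 * e$2) * u$2"
    by (simp add: D_def algebra_simps)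
  have 2: "r$2 * D = (r$1 * e$1 + r$2 * e$2) * u$1 - (r$1 * u$1 + r$2 * u$2) * e$1"
    by (simp add: D_def algebra_simps)
  have "r$1 = 0" "r$2 = 0" using 1 2 \<open>D \<noteq> 0\<close> unfolding ru re by simp_all
  then have "r = 0" by (simp add: vec_eq_iff forall_2)
  then show ?thesis by (simp add: r_def)
qed

text \<open>A supporting line at \<open>w\<close> with inner normal \<open>a\<close> is not parallel
  to \<open>e\<close>: otherwise \<open>w + e\<close> would be a second frontier point with the same
  projection. Invariance under upward translation makes \<open>a \<bullet> e\<close> nonnegative,
  and solving for the \<open>e\<close> coordinate gives the subgradient
  \<open>\<sigma>\<close>.\<close>

lemma frontier_support:
  fixes \<Omega>0 :: "(real^2) set"
  assumes ne: "\<Omega>0 \<noteq> {}" and op: "open \<Omega>0" and cv: "convex \<Omega>0"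
    and inj: "inj_on (\<lambda>w. w \<bullet> u) (frontier \<Omega>0)"
    and ue: "norm u = 1" "norm e = 1" "e \<bullet> u = 0"
    and up: "\<And>z t. z \<in> \<Omega>0 \<Longrightarrow> t \<ge> 0 \<Longrightarrow> z + t *\<^sub>R e \<in> \<Omega>0"
    and w: "w \<in> frontier \<Omega>0"
  shows "\<exists>\<sigma>. \<forall>z \<in> frontier \<Omega>0. z \<bullet> e \<ge> w \<bullet> e + \<sigma> * (z \<bullet> u - w \<bullet> u)"
proof -
  have wc: "w \<in> closure \<Omega>0" "w \<notin> \<Omega>0" using w op by (auto simp: frontier_def interior_open)
  then have "w \<notin> rel_interior \<Omega>0" using rel_interior_subset by blast
  then obtain a where a: "a \<noteq> 0" "\<And>z. z \<in> closure \<Omega>0 \<Longrightarrow> a \<bullet> w \<le> a \<bullet> z"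
    "\<And>z. z \<in> rel_interior \<Omega>0 \<Longrightarrow> a \<bullet> w < a \<bullet> z"
    using supporting_hyperplane_relative_frontier[OF cv wc(1)] by metis
  have ae: "a = (a \<bullet> u) *\<^sub>R u + (a \<bullet> e) *\<^sub>R e" by (rule plane_decomp[OF ue])
  obtain z0 where z0: "z0 \<in> \<Omega>0" using ne by blast
  have ge: "a \<bullet> e \<ge> 0"
  proof (rule ccontr)
    assume n: "\<not> 0 \<le> a \<bullet> e"
    \<comment> \<open>Moving \<open>z0\<close> up by this amount would lower its product with
      \<open>a\<close> to \<open>a \<bullet> w - 1\<close>, below the support bound.\<close>
    let ?t = "(a \<bullet> z0 - a \<bullet> w + 1) / - (a \<bullet> e)"
    have z0w: "a \<bullet> w \<le> a \<bullet> z0" using a(2) z0 closure_subset by blast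
    then have "?t \<ge> 0" using n by (auto intro!: divide_nonneg_pos simp del: divide_minus_right)
    then have "a \<bullet> w \<le> a \<bullet> (z0 + ?t *\<^sub>R e)"
      using a(2) up[OF z0] closure_subset by blast
    also have "\<dots> = a \<bullet> z0 + ?t * (a \<bullet> e)" by (simp only: inner_add_right inner_scaleR_right)
    also have "?t * (a \<bullet> e) = - (a \<bullet> z0 - a \<bullet> w + 1)" using n by (simp add: field_simps)
    finally show False by simp
  qed
  have "a \<bullet> e \<noteq> 0"
  proof
    assume 0: "a \<bullet> e = 0"
    have "w + e \<in> closure \<Omega>0"
    proof -
      obtain f where f: "\<And>n. f n \<in> \<Omega>0" "f \<longlonglongrightarrow> w" using wc(1) unfolding closure_sequential by blast
      have "(\<lambda>n. f n + 1 *\<^sub>R e) \<longlonglongrightarrow> w + 1 *\<^sub>R e" by (intro tendsto_intros f)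
      moreover have "\<And>n. f n + 1 *\<^sub>R e \<in> \<Omega>0" using f(1) up zero_le_one by blast
      ultimately show ?thesis unfolding closure_sequential by force
    qed
    moreover have "w + e \<notin> \<Omega>0"
    proof
      assume "w + e \<in> \<Omega>0"
      then have "w + e \<in> rel_interior \<Omega>0" using op by (simp add: rel_interior_open)
      then have "a \<bullet> w < a \<bullet> (w + e)" using a(3) by blast
      then show False using 0 by (simp add: inner_add_right)
    qed
    ultimately have "w + e \<in> frontier \<Omega>0" using op by (simp add: frontier_def interior_open)
    then have "w + e = w" using w ue(3) by (intro inj_onD[OF inj]) (auto simp: inner_add_left)
    then show False using ue(2) by simp
  qed
  with ge have pos: "a \<bullet> e > 0" by simp
  show ?thesis
  proof (intro exI[of _ "- (a \<bullet> u) / (a \<bullet> e)"] ballI)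
    fix z assume "z \<in> frontier \<Omega>0"
    then have "a \<bullet> w \<le> a \<bullet> z" using a(2) by (simp add: frontier_def)
    moreover have av: "a \<bullet> v = (a \<bullet> u) * (v \<bullet> u) + (a \<bullet> e) * (v \<bullet> e)" for v
      using arg_cong[OF ae, of "\<lambda>x. x \<bullet> v"]
      by (simp only: inner_add_left inner_scaleR_left inner_commute[of u v] inner_commute[of e v])
    ultimately have "(a \<bullet> u) * (w \<bullet> u) + (a \<bullet> e) * (w \<bullet> e) \<le> (a \<bullet> u) * (z \<bullet> u) + (a \<bullet> e) * (z \<bullet> e)"
      using av[of w] av[of z] by linarith
    then have "- (a \<bullet> u) * (z \<bullet> u - w \<bullet> u) \<le> (z \<bullet> e - w \<bullet> e) * (a \<bullet> e)"
      by (simp add: algebra_simps)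
    then have "- (a \<bullet> u) * (z \<bullet> u - w \<bullet> u) / (a \<bullet> e) \<le> z \<bullet> e - w \<bullet> e"
      by (simp only: pos_divide_le_eq[OF pos])
    then show "z \<bullet> e \<ge> w \<bullet> e + - (a \<bullet> u) / (a \<bullet> e) * (z \<bullet> u - w \<bullet> u)"
      by simp
  qed
qed

text \<open>Convexity in three-point form, cleared of denominators so that coinciding projections
  need no separate case. The support inequality at \<open>B\<close> is tested at \<open>A\<close>
  and \<open>C\<close> and weighted so that the slope \<open>\<sigma>\<close> cancels.\<close>

lemma chord_inequality:
  fixes \<Gamma> :: "'a::real_inner set"
  assumes supp: "\<And>w. w \<in> \<Gamma> \<Longrightarrow> \<exists>\<sigma>. \<forall>z \<in> \<Gamma>. z \<bullet> e \<ge> w \<bullet> e + \<sigma> * (z \<bullet> u - w \<bullet> u)"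
    and "A \<in> \<Gamma>" "B \<in> \<Gamma>" "C \<in> \<Gamma>" "A \<bullet> u \<le> B \<bullet> u" "B \<bullet> u \<le> C \<bullet> u"
  shows "(B \<bullet> e - A \<bullet> e) * (C \<bullet> u - A \<bullet> u) \<le> (C \<bullet> e - A \<bullet> e) * (B \<bullet> u - A \<bullet> u)"
proof -
  obtain \<sigma> where s: "\<forall>z \<in> \<Gamma>. z \<bullet> e \<ge> B \<bullet> e + \<sigma> * (z \<bullet> u - B \<bullet> u)" using supp assms by blast
  have "A \<bullet> e \<ge> B \<bullet> e + \<sigma> * (A \<bullet> u - B \<bullet> u)" "C \<bullet> e \<ge> B \<bullet> e + \<sigma> * (C \<bullet> u - B \<bullet> u)" using s assms by auto
  then have "(C \<bullet> u - B \<bullet> u) * (A \<bullet> e) \<ge> (C \<bullet> u - B \<bullet> u) * (B \<bullet> e + \<sigma> * (A \<bullet> u - B \<bullet> u))"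
    "(B \<bullet> u - A \<bullet> u) * (C \<bullet> e) \<ge> (B \<bullet> u - A \<bullet> u) * (B \<bullet> e + \<sigma> * (C \<bullet> u - B \<bullet> u))"
    using assms by (auto intro!: mult_left_mono)
  then show ?thesis by (simp add: algebra_simps)
qed

section \<open>The rising sun lemma\<close>

lemma is_interval_Inf_Sup:
  fixes J :: "real set"
  assumes "is_interval J" "bounded J" "J \<noteq> {}"
  shows "{Inf J<..<Sup J} \<subseteq> J" "J \<subseteq> {Inf J..Sup J}"
proof -
  have bdd: "bdd_above J" "bdd_below J"
    using assms(2) by (auto intro: bounded_imp_bdd_above bounded_imp_bdd_below)
  show "J \<subseteq> {Inf J..Sup J}" using bdd by (auto intro: cInf_lower cSup_upper)
  show "{Inf J<..<Sup J} \<subseteq> J"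
  proof
    fix x assume x: "x \<in> {Inf J<..<Sup J}"
    obtain y where "y \<in> J" "y < x" using x cInf_less_iff[OF assms(3) bdd(2)] by auto
    moreover obtain z where "z \<in> J" "x < z" using x less_cSup_iff[OF assms(3) bdd(1)] by auto
    ultimately show "x \<in> J" using assms(1) unfolding is_interval_1 by (meson less_imp_le)
  qed
qed

lemma sets_lebesgue_between:
  fixes J :: "real set"
  assumes "{p<..<q} \<subseteq> J" "J \<subseteq> {p..q}"
  shows "J \<in> sets lebesgue"
proof -
  have "J = {p<..<q} \<union> (J \<inter> {p, q})" using assms by fastforce
  moreover have "J \<inter> {p, q} \<in> sets borel" by (intro borel_closed finite_imp_closed) auto
  ultimately have "J \<in> sets borel" by (metis borel_open open_greaterThanLessThan sets.Un)
  then show ?thesis by (simp add: sets_completionI_sets)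
qed

lemma set_lebesgue_integral_between:
  fixes f :: "real \<Rightarrow> 'a::euclidean_space"
  assumes f: "f absolutely_integrable_on {a..b}" and "a \<le> p" "p \<le> q" "q \<le> b"
    and J: "{p<..<q} \<subseteq> J" "J \<subseteq> {p..q}"
  shows "(LINT s:J|lebesgue. f s) = integral {a..q} f - integral {a..p} f"
proof -
  have "set_integrable lebesgue J f"
    using assms by (intro set_integrable_subset[OF f] sets_lebesgue_between[OF J]) auto
  then have "(LINT s:J|lebesgue. f s) = integral J f" by (rule set_lebesgue_integral_eq_integral)
  also have "\<dots> = integral {p..q} f"
  proof (rule integral_spike_set)
    have "{p..q} \<subseteq> insert p (insert q J)" using J(1) by (force simp: subset_eq)
    moreover have "negligible {p, q}" by simp
    ultimately show "negligible {x \<in> {p..q} - J. f x \<noteq> 0}"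
      by (elim negligible_subset) blast
    have "{x \<in> J - {p..q}. f x \<noteq> 0} = {}" using J by blast
    then show "negligible {x \<in> J - {p..q}. f x \<noteq> 0}" by (simp only: negligible_empty)
  qed
  also have "\<dots> = integral {a..q} f - integral {a..p} f"
  proof -
    have "f integrable_on {a..q}" using f assms
      by (meson integrable_on_subinterval set_lebesgue_integral_eq_integral(1) atLeastatMost_subset_iff order_refl order_trans)
    then have "integral {a..p} f + integral {p..q} f = integral {a..q} f"
      using assms by (intro Henstock_Kurzweil_Integration.integral_combine) auto
    then show ?thesis by (simp add: algebra_simps)
  qed
  finally show ?thesis .
qed

lemma absolutely_integrable_between:
  fixes f :: "real \<Rightarrow> 'a::euclidean_space"
  assumes f: "f absolutely_integrable_on J" and J: "{p<..<q} \<subseteq> J" "J \<subseteq> {p..q}"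
  shows "f absolutely_integrable_on {p..q}"
proof -
  have "{p..q} \<subseteq> insert p (insert q J)" using J(1) by (force simp: subset_eq)
  moreover have "negligible {p, q}" by simp
  ultimately have 1: "negligible {x \<in> {p..q} - J. f x \<noteq> 0}" by (elim negligible_subset) blast
  have "{x \<in> J - {p..q}. f x \<noteq> 0} = {}" using J by blast
  then have 2: "negligible {x \<in> J - {p..q}. f x \<noteq> 0}" by (simp only: negligible_empty)
  show ?thesis using absolutely_integrable_spike_set_eq[OF 2 1] f by simp
qed

text \<open>A component is relatively closed in \<open>U\<close>, so an endpoint lying in
  \<open>U\<close> would belong to the component itself, which is impossible for an open
  interval.\<close>

lemma connected_component_interval:
  fixes U :: "real set"
  assumes U: "open U" "bounded U" and x: "x \<in> U"
  obtains p q where "p < q" "connected_component_set U x = {p<..<q}" "p \<notin> U" "q \<notin> U"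
proof -
  define C where "C = connected_component_set U x"
  have CU: "C \<subseteq> U" and xC: "x \<in> C" and opC: "open C"
    unfolding C_def using x U by (auto simp: connected_component_subset open_connected_component)
  have "is_interval C" unfolding C_def by (simp add: is_interval_connected_1)
  moreover have "bounded C" using CU U(2) bounded_subset by blast
  moreover have "C \<noteq> {}" using xC by blast
  ultimately have I: "{Inf C<..<Sup C} \<subseteq> C" "C \<subseteq> {Inf C..Sup C}"
    by (rule is_interval_Inf_Sup)+
  define p q where "p = Inf C" and "q = Sup C"
  have "C \<subseteq> interior {p..q}" using I opC unfolding p_def q_def by (intro interior_maximal) auto
  then have C: "C = {p<..<q}" using I unfolding p_def q_def by (simp add: interior_atLeastAtMost_real)
  then have pq: "p < q" using xC by auto
  have "closedin (top_of_set U) C" unfolding C_def by (rule closedin_connected_component)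
  then obtain T where T: "closed T" "C = U \<inter> T" unfolding closedin_closed by blast
  have "{p..q} \<subseteq> T"
    using T C pq by (metis closure_greaterThanLessThan closure_minimal inf_le2)
  then have "p \<in> U \<Longrightarrow> p \<in> C" "q \<in> U \<Longrightarrow> q \<in> C" using T pq by auto
  then have "p \<notin> U" "q \<notin> U" using C by auto
  then show thesis using that pq C C_def by blast
qed

text \<open>Countable additivity over the components of \<open>U\<close>: the intervals inside
  \<open>U\<close> with both ends outside \<open>U\<close> are exactly these components.\<close>

lemma set_integral_open_nonpos:
  fixes f :: "real \<Rightarrow> real"
  assumes U: "open U" "bounded U" and f: "set_integrable lebesgue U f"
    and comp: "\<And>p q. p < q \<Longrightarrow> {p<..<q} \<subseteq> U \<Longrightarrow> p \<notin> U \<Longrightarrow> q \<notin> U \<Longrightarrow>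
      (LINT x:{p<..<q}|lebesgue. f x) \<le> 0"
  shows "(LINT x:U|lebesgue. f x) \<le> 0"
proof -
  define K where "K = components U"
  have "countable K"
  proof (rule countable_disjoint_open_subsets)
    show "open S" if "S \<in> K" for S using that U unfolding K_def by (simp add: open_components)
    show "pairwise disjnt K" unfolding K_def disjnt_def by (rule pairwise_disjoint_components)
  qed
  then have inj: "inj_on (to_nat_on K) K" by (rule inj_on_to_nat_on)
  \<comment> \<open>\<open>A n\<close> is the component numbered \<open>n\<close>, or empty if no
    component has that number; this turns the components into a disjoint sequence.\<close>
  define A where "A n = {x \<in> U. to_nat_on K (connected_component_set U x) = n}" for n
  have A: "A n = {} \<or> (\<exists>p q. p < q \<and> A n = {p<..<q} \<and> {p<..<q} \<subseteq> U \<and> p \<notin> U \<and> q \<notin> U)" for n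
  proof (cases "A n = {}")
    case False
    then obtain x where x: "x \<in> U" "to_nat_on K (connected_component_set U x) = n" unfolding A_def by blast
    have "A n = connected_component_set U x"
    proof (intro equalityI subsetI)
      fix y assume "y \<in> A n"
      then have y: "y \<in> U" "to_nat_on K (connected_component_set U y) = n" unfolding A_def by auto
      then have "connected_component_set U y = connected_component_set U x"
        using x by (intro inj_onD[OF inj]) (auto simp: K_def componentsI)
      then show "y \<in> connected_component_set U x" 
        using y(1) connected_component_refl by blast
    next
      fix y assume y: "y \<in> connected_component_set U x"
      then have "connected_component_set U y = connected_component_set U x"
        by (simp add: connected_component_eq)
      moreover have "y \<in> U" using y connected_component_subset by blast
      ultimately show "y \<in> A n" using x unfolding A_def by simp
    qed
    moreover obtain p q where "p < q" "connected_component_set U x = {p<..<q}" "p \<notin> U" "q \<notin> U"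
      using connected_component_interval[OF U x(1)] .
    ultimately show ?thesis using connected_component_subset[of U x] by blast
  qed simp
  have UA: "U = (\<Union>n. A n)" unfolding A_def by auto
  have mA: "A n \<in> sets lebesgue" for n using A[of n] by auto
  have fA: "set_integrable lebesgue B f" if "B \<in> sets lebesgue" "B \<subseteq> U" for B
    using that f by (intro set_integrable_subset[OF f]) auto
  have AU: "A n \<subseteq> U" for n by (auto simp: A_def)
  have "set_lebesgue_integral lebesgue (\<Union>i<n. A i) f \<le> 0" for n
  proof (induct n)
    case (Suc n)
    have "set_lebesgue_integral lebesgue ((\<Union>i<n. A i) \<union> A n) f
        = set_lebesgue_integral lebesgue (\<Union>i<n. A i) f + set_lebesgue_integral lebesgue (A n) f"
    proof (rule set_integral_Un)
      show "(\<Union>i<n. A i) \<inter> A n = {}" by (auto simp: A_def)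
      show "set_integrable lebesgue (\<Union>i<n. A i) f"
        using AU by (intro fA sets.finite_UN mA) auto
      show "set_integrable lebesgue (A n) f" by (intro fA mA AU)
    qed
    moreover have "set_lebesgue_integral lebesgue (A n) f \<le> 0"
      using A[of n] comp by (auto simp: set_lebesgue_integral_def)
    ultimately show ?case using Suc by (simp add: lessThan_Suc Un_commute)
  qed (simp add: set_lebesgue_integral_def)
  moreover have "(\<lambda>n. set_lebesgue_integral lebesgue (\<Union>i<n. A i) f)
      \<longlonglongrightarrow> set_lebesgue_integral lebesgue (\<Union>n. \<Union>i<n. A i) f"
  proof (rule set_integral_cont_up)
    show "incseq (\<lambda>n. \<Union>i<n. A i)" by (force simp: incseq_def)
    show "set_integrable lebesgue (\<Union>n. \<Union>i<n. A i) f" 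
      using AU by (intro fA sets.countable_UN'' sets.finite_UN mA) auto
    show "(\<Union>i<n. A i) \<in> sets lebesgue" for n by (intro sets.finite_UN mA) auto
  qed
  moreover have "(\<Union>n. \<Union>i<n. A i) = U" using UA by blast
  ultimately show ?thesis using LIMSEQ_le_const2 by force
qed

text \<open>The classical choice \<open>\<exists>y>x. F x < F y\<close> may leave a component starting at \<open>a\<close> with
  \<open>F a < F q\<close>; the minimum with \<open>F a\<close> makes the values at both ends of every component agree.\<close>

lemma rising_sun_set:
  fixes F :: "real \<Rightarrow> real"
  assumes F: "continuous_on {a..b} F" and Fba: "F b \<le> F a"
  defines "U \<equiv> {x \<in> {a<..<b}. \<exists>y\<in>{x..b}. min (F x) (F a) < F y}"
  shows "open U"
    and "\<And>p q. p < q \<Longrightarrow> {p<..<q} \<subseteq> U \<Longrightarrow> p \<notin> U \<Longrightarrow> q \<notin> U \<Longrightarrow> F p = F q"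
    and "\<And>x y. x \<in> {a<..<b} - U \<Longrightarrow> y \<in> {x..b} \<Longrightarrow> F y \<le> F x \<and> F y \<le> F a"
proof -
  have Fi: "isCont F x" if "x \<in> {a<..<b}" for x
    using that F by (metis continuous_on_interior interior_atLeastAtMost_real)
  show out: "F y \<le> F x \<and> F y \<le> F a" if "x \<in> {a<..<b} - U" "y \<in> {x..b}" for x y
  proof -
    have "F y' \<le> min (F x) (F a)" if "y' \<in> {x..b}" for y'
      using that \<open>x \<in> {a<..<b} - U\<close> by (force simp: U_def)
    then show ?thesis using \<open>y \<in> {x..b}\<close> by auto
  qed
  show "open U"
  proof (rule openI)
    fix x assume x: "x \<in> U"
    then have xab: "x \<in> {a<..<b}" by (simp add: U_def)
    obtain y where y: "y \<in> {x..b}" "min (F x) (F a) < F y" using x by (auto simp: U_def)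
    have ab: "\<forall>\<^sub>F z in nhds x. z \<in> {a<..<b}" using xab by (intro eventually_nhds_in_open) auto
    have c: "(F \<longlongrightarrow> F x) (nhds x)"
      using Fi[OF xab] by (simp add: isCont_def tendsto_at_iff_tendsto_nhds)
    have "\<forall>\<^sub>F z in nhds x. z \<in> U"
    \<comment> \<open>In the first case nearby points are their own witnesses. Otherwise the witness
      \<open>y\<close> lies strictly to the right of \<open>x\<close> and stays valid for nearby
      points.\<close>
    proof (cases "F a < F x")
      case True
      then have "\<forall>\<^sub>F z in nhds x. F a < F z" using c by (rule order_tendstoD(1)[rotated])
      with ab show ?thesis by eventually_elim (auto simp: U_def intro!: bexI)
    next
      case False
      then have Fy: "F x < F y" using y by auto
      then have "y > x" using y by (cases "y = x") auto
      then have "\<forall>\<^sub>F z in nhds x. z \<in> {..<y}" by (intro eventually_nhds_in_open) auto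
      moreover have "\<forall>\<^sub>F z in nhds x. F z < F y" using c Fy by (rule order_tendstoD(2))
      ultimately show ?thesis using ab
        by eventually_elim (use y in \<open>auto simp: U_def intro!: bexI[of _ y]\<close>)
    qed
    then obtain e where "e > 0" "\<forall>z. dist z x < e \<longrightarrow> z \<in> U" by (auto simp: eventually_nhds_metric)
    then show "\<exists>T>0. ball x T \<subseteq> U" by (auto simp: dist_commute subset_eq)
  qed
  fix p q assume pq: "p < q" "{p<..<q} \<subseteq> U" "p \<notin> U" "q \<notin> U"
  have Uab: "U \<subseteq> {a<..<b}" by (auto simp: U_def)
  have pqab: "a \<le> p" "q \<le> b"
  proof -
    show "a \<le> p"
    proof (rule ccontr)
      assume "\<not> a \<le> p"
      then have "(p + min q a) / 2 \<in> {p<..<q} - {a<..<b}" using pq(1) by (auto simp: min_def)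
      then show False using pq(2) Uab by blast
    qed
    show "q \<le> b"
    proof (rule ccontr)
      assume "\<not> q \<le> b"
      then have "(q + max p b) / 2 \<in> {p<..<q} - {a<..<b}" using pq(1) by (auto simp: max_def)
      then show False using pq(2) Uab by blast
    qed
  qed
  \<comment> \<open>At \<open>q = b\<close> the bound comes from \<open>Fba\<close>; elsewhere it
    comes from \<open>q\<close> lying outside \<open>U\<close>.\<close>
  have qb: "F y \<le> F q \<and> F y \<le> F a" if "y \<in> {q..b}" for y
  proof (cases "q = b")
    case True then show ?thesis using that Fba by auto
  next
    case False then show ?thesis using out[of q y] that pq pqab by auto
  qed
  have mid: "min (F x) (F a) \<le> F q" if x: "x \<in> {p<..<q}" for x
  proof (rule ccontr)
    define m where "m = min (F x) (F a)"
    assume "\<not> min (F x) (F a) \<le> F q"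
    then have m: "F q < m" unfolding m_def by linarith
    \<comment> \<open>Let \<open>z\<close> be the last point of \<open>{x..q}\<close> with
      \<open>m \<le> F z\<close>. As a point of \<open>U\<close> it has a witness
      \<open>y \<ge> z\<close> with \<open>F y > m\<close>, which lies before \<open>q\<close> and
      hence equals \<open>z\<close>. So \<open>F z > m\<close>, and continuity yields points of
      \<open>Z\<close> beyond \<open>z\<close>.\<close>
    define Z where "Z = {z \<in> {x..q}. m \<le> F z}"
    have Fxq: "continuous_on {x..q} F" using F x pqab by (auto elim: continuous_on_subset)
    have "Z = {x..q} \<inter> F -` {m..}" by (auto simp: Z_def)
    then have "closed Z" using continuous_closed_preimage[OF Fxq closed_atLeastAtMost closed_atLeast] by simp
    moreover have xZ: "x \<in> Z" using x by (auto simp: Z_def m_def)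
    moreover have bdd: "bdd_above Z" by (auto simp: Z_def)
    ultimately have "Sup Z \<in> Z" by (intro closed_contains_Sup) auto
    define z where "z = Sup Z"
    have z: "x \<le> z" "z \<le> q" "m \<le> F z" using \<open>Sup Z \<in> Z\<close> by (auto simp: z_def Z_def)
    have "z < q" using z m by (cases "z = q") auto
    then have zU: "z \<in> U" using pq(2) x z by auto
    then obtain y where y: "y \<in> {z..b}" "min (F z) (F a) < F y" by (auto simp: U_def)
    then have my: "m < F y" using z unfolding m_def by (auto simp: min_def split: if_splits)
    then have "y < q" using qb[of y] y m by force
    then have "y \<in> Z" using y my z by (auto simp: Z_def)
    then have "y \<le> z" unfolding z_def using bdd by (rule cSup_upper)
    then have mz: "m < F z" using y my by auto
    have "isCont F z" using Fi zU by (simp add: U_def)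
    then have "\<forall>\<^sub>F w in nhds z. m < F w"
      using mz by (intro order_tendstoD(1)) (simp add: isCont_def tendsto_at_iff_tendsto_nhds)
    moreover have "\<forall>\<^sub>F w in nhds z. w \<in> {..<q}" using \<open>z < q\<close> by (intro eventually_nhds_in_open) auto
    ultimately have "\<forall>\<^sub>F w in nhds z. m < F w \<and> w \<in> {..<q}" by (rule eventually_conj)
    then obtain e where e: "e > 0" "\<And>w. dist w z < e \<Longrightarrow> m < F w \<and> w < q"
      by (auto simp: eventually_nhds_metric)
    have "z + e/2 \<in> Z" using e(2)[of "z + e/2"] e(1) z by (auto simp: Z_def dist_real_def)
    then have "z + e/2 \<le> z" unfolding z_def using bdd by (rule cSup_upper)
    then show False using e by simp
  qed
  \<comment> \<open>Letting \<open>x\<close> tend to \<open>p\<close> from the right carries the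
    bound \<open>mid\<close> over to \<open>p\<close>.\<close>
  have "((\<lambda>x. min (F x) (F a)) \<longlongrightarrow> min (F p) (F a)) (at p within {p..q})"
  proof (intro tendsto_intros)
    have "continuous_on {p..q} F" using F pqab by (auto elim: continuous_on_subset)
    then show "(F \<longlongrightarrow> F p) (at p within {p..q})" using pq(1) by (simp add: continuous_on_def)
  qed
  moreover have "\<forall>\<^sub>F x in at p within {p..q}. min (F x) (F a) \<le> F q"
    unfolding eventually_at using pq mid
    by (intro exI[of _ "q - p"]) (auto simp: dist_real_def)
  moreover have "at p within {p..q} \<noteq> bot"
    using pq(1) by (simp add: at_within_Icc_at_right)
  ultimately have lim: "min (F p) (F a) \<le> F q" by (intro tendsto_upperbound)
  have qa: "F q \<le> F a" using qb[of q] pqab by auto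
  show "F p = F q"
  proof (cases "p = a")
    case True
    then show ?thesis using lim qa by auto
  next
    case False
    then have "F q \<le> F p \<and> F p \<le> F a" using out[of p q] out[of p p] pq pqab by auto
    then show ?thesis using lim by auto
  qed
qed

text \<open>With \<open>F\<close> a primitive of \<open>f\<close>, equal values at the ends of a
  component mean that the integral of \<open>f\<close> over it vanishes. For the sign off
  \<open>U\<close>, the integral of \<open>f\<close> over the set \<open>S\<close> where
  \<open>f\<close> is positive off \<open>U\<close> is shown to be at most 0, so \<open>S\<close>
  must be null.\<close>

lemma rising_sun:
  fixes f :: "real \<Rightarrow> real"
  assumes f: "f absolutely_integrable_on {a..b}" and ab: "a < b"
    and le: "(LINT x:{a..b}|lebesgue. f x) \<le> 0"
  obtains U where "open U" "U \<subseteq> {a<..<b}"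
    "\<forall>p q. p < q \<and> {p<..<q} \<subseteq> U \<and> p \<notin> U \<and> q \<notin> U \<longrightarrow> (LINT x:{p<..<q}|lebesgue. f x) = 0"
    "AE x in lebesgue. x \<in> {a<..<b} - U \<longrightarrow> f x \<le> 0"
proof -
  define F where "F x = integral {a..x} f" for x
  have int: "(LINT s:J|lebesgue. f s) = F q - F p"
    if "a \<le> p" "p \<le> q" "q \<le> b" "{p<..<q} \<subseteq> J" "J \<subseteq> {p..q}" for p q J
    unfolding F_def by (rule set_lebesgue_integral_between[OF f that])
  have intO: "(LINT s:{p<..<q}|lebesgue. f s) = F q - F p" if "a \<le> p" "p \<le> q" "q \<le> b" for p q
    using that by (intro int) (auto simp: subset_eq)
  have Fc: "continuous_on {a..b} F" unfolding F_def
    by (intro indefinite_integral_continuous_1 set_lebesgue_integral_eq_integral(1)[OF f])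
  have Fba: "F b \<le> F a" using le int[of a b "{a..b}"] ab by (force simp: subset_eq)
  define U where "U = {x \<in> {a<..<b}. \<exists>y\<in>{x..b}. min (F x) (F a) < F y}"
  have opU: "open U" and Ucomp: "\<And>p q. p < q \<Longrightarrow> {p<..<q} \<subseteq> U \<Longrightarrow> p \<notin> U \<Longrightarrow> q \<notin> U \<Longrightarrow> F p = F q"
    and Uout: "\<And>x y. x \<in> {a<..<b} - U \<Longrightarrow> y \<in> {x..b} \<Longrightarrow> F y \<le> F x \<and> F y \<le> F a"
    unfolding U_def by (fact rising_sun_set[OF Fc Fba])+
  have Uab: "U \<subseteq> {a<..<b}" by (auto simp: U_def)
  have pqab: "a \<le> p \<and> q \<le> b" if "p < q" "{p<..<q} \<subseteq> {a<..<b}" for p q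
    using that greaterThanLessThan_subseteq_greaterThanLessThan[of p q a b] by simp
  have fs: "set_integrable lebesgue B f" if "B \<in> sets lebesgue" "B \<subseteq> {a<..<b}" for B
    using that by (intro set_integrable_subset[OF f]) auto
  have U0: "(LINT x:{p<..<q}|lebesgue. f x) = 0"
    if "p < q" "{p<..<q} \<subseteq> U" "p \<notin> U" "q \<notin> U" for p q
    using intO[of p q] Ucomp[OF that] pqab[of p q] that Uab by auto
  have bU: "bounded U" using bounded_subset[OF _ Uab] by simp
  have fU: "set_integrable lebesgue U f" using opU Uab by (intro fs) auto
  \<comment> \<open>Nonnegativity of the integral over \<open>U\<close> is what later allows
    \<open>U\<close> to be subtracted from \<open>V \<union> U\<close>.\<close>
  have "(LINT x:U|lebesgue. - f x) \<le> 0"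
  proof (rule set_integral_open_nonpos[OF opU bU])
    show "set_integrable lebesgue U (\<lambda>x. - f x)" using fU by (simp add: set_integrable_def)
    show "(LINT x:{p<..<q}|lebesgue. - f x) \<le> 0"
      if "p < q" "{p<..<q} \<subseteq> U" "p \<notin> U" "q \<notin> U" for p q
      using U0[OF that] by (simp add: set_lebesgue_integral_def)
  qed
  then have iU: "(LINT x:U|lebesgue. f x) \<ge> 0" using fU by (simp add: set_integral_uminus)
  \<comment> \<open>Almost everywhere nonpositivity off \<open>U\<close> is obtained from outer regularity of the set where it
    fails, since the components of \<open>V \<union> U\<close> again end outside \<open>U\<close>; no differentiation theorem
    is needed.\<close>
  have V: "(LINT x:V - U|lebesgue. f x) \<le> 0" if "open V" "V \<subseteq> {a<..<b}" for V
  proof -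
    have VU: "open (V \<union> U)" "V \<union> U \<subseteq> {a<..<b}" using that opU Uab by auto
    have "(LINT x:V \<union> U|lebesgue. f x) \<le> 0"
    proof (rule set_integral_open_nonpos)
      show "open (V \<union> U)" by (rule VU)
      show "bounded (V \<union> U)" using bounded_subset[OF _ VU(2)] by simp
      show "set_integrable lebesgue (V \<union> U) f" using VU by (intro fs) auto
      fix p q assume pq: "p < q" "{p<..<q} \<subseteq> V \<union> U" "p \<notin> V \<union> U" "q \<notin> V \<union> U"
      then have ab': "a \<le> p \<and> q \<le> b" using VU(2) by (intro pqab) auto
      \<comment> \<open>The end \<open>p\<close> is outside \<open>U\<close>, so later values are at
        most \<open>F p\<close>. If \<open>p = a\<close>, the bound by \<open>F a\<close> comes from
        \<open>q\<close> being outside \<open>U\<close>, or from \<open>Fba\<close> when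
        \<open>q = b\<close>.\<close>
      have "F q \<le> F p"
      proof (cases "p = a")
        case True
        then show ?thesis using Uout[of q q] ab' pq Fba by (cases "q = b") auto
      next
        case False
        then show ?thesis using Uout[of p q] ab' pq by auto
      qed
      then show "(LINT x:{p<..<q}|lebesgue. f x) \<le> 0"
        using intO[of p q] ab' pq by auto
    qed
    moreover have "(V - U) \<union> U = V \<union> U" by blast
    moreover have "set_lebesgue_integral lebesgue ((V - U) \<union> U) f
        = set_lebesgue_integral lebesgue (V - U) f + set_lebesgue_integral lebesgue U f"
      using that opU Uab by (intro set_integral_Un fs) auto
    ultimately show ?thesis using iU by simp
  qed
  have fm: "f \<in> borel_measurable (lebesgue_on {a..b})"
    using f by (intro absolutely_integrable_imp_borel_measurable) auto
  define S where "S = {x \<in> {a<..<b} - U. 0 < f x}"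
  have mS: "S \<in> sets lebesgue"
  proof -
    have "{x \<in> space (lebesgue_on {a..b}). 0 < f x} \<in> sets (lebesgue_on {a..b})"
      using fm by measurable
    then have "{x \<in> {a..b}. 0 < f x} \<in> sets lebesgue"
      by (simp add: sets_restrict_space_iff space_restrict_space) 
    moreover have "S = {x \<in> {a..b}. 0 < f x} \<inter> ({a<..<b} - U)" by (auto simp: S_def)
    moreover have "{a<..<b} - U \<in> sets lebesgue" using opU by auto
    ultimately show ?thesis by simp
  qed
  have "\<forall>n. \<exists>T. open T \<and> S \<subseteq> T \<and> T - S \<in> lmeasurable \<and> emeasure lebesgue (T - S) < ennreal (1 / real (Suc n))"
  proof
    fix n :: nat
    show "\<exists>T. open T \<and> S \<subseteq> T \<and> T - S \<in> lmeasurable \<and> emeasure lebesgue (T - S) < ennreal (1 / real (Suc n))"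
      using sets_lebesgue_outer_open[OF mS, of "1 / real (Suc n)"] by (metis of_nat_0_less_iff zero_less_Suc zero_less_divide_1_iff)
  qed
  then obtain T where T: "\<And>n. open (T n)" "\<And>n. S \<subseteq> T n" "\<And>n. T n - S \<in> lmeasurable"
    "\<And>n. emeasure lebesgue (T n - S) < ennreal (1 / real (Suc n))"
    unfolding choice_iff by blast
  \<comment> \<open>Finite intersections make the outer approximations of \<open>S\<close>
    decreasing. The limit \<open>D\<close> of \<open>W n - U\<close> differs from \<open>S\<close>
    by a null set, so the bound \<open>V\<close> for open sets passes to \<open>S\<close>.\<close>
  define W where "W n = (\<Inter>i\<le>n. T i) \<inter> {a<..<b}" for n
  have W: "open (W n)" "W n \<subseteq> {a<..<b}" for n
    unfolding W_def using T(1) by (auto intro!: open_Int open_INT)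
  have SW: "S \<subseteq> W n - U" for n using T(2) by (auto simp: W_def S_def)
  have mW: "W n - U \<in> sets lebesgue" for n using W(1) opU by auto
  define D where "D = (\<Inter>n. W n - U)"
  have mD: "D \<in> sets lebesgue" unfolding D_def using mW by (intro sets.countable_INT'') auto
  have "(\<lambda>n. set_lebesgue_integral lebesgue (W n - U) f) \<longlonglongrightarrow> set_lebesgue_integral lebesgue D f"
    unfolding D_def
  proof (rule set_integral_cont_down)
    show "decseq (\<lambda>n. W n - U)" by (force simp: decseq_def W_def)
    show "set_integrable lebesgue (W 0 - U) f" using W(2)[of 0] by (intro fs mW) auto
  qed (rule mW)
  then have D0: "set_lebesgue_integral lebesgue D f \<le> 0"
    using V[OF W] by (intro LIMSEQ_le_const2) auto
  have "D - S \<in> null_sets lebesgue"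
  proof -
    have "emeasure lebesgue (D - S) \<le> ennreal (1 / real (Suc n))" for n
    proof -
      have "D - S \<subseteq> T n - S" by (auto simp: D_def W_def)
      then have "emeasure lebesgue (D - S) \<le> emeasure lebesgue (T n - S)"
        using T(3)[of n] by (intro emeasure_mono) (auto simp: fmeasurable_def)
      then show ?thesis using T(4)[of n] by simp
    qed
    moreover have "(\<lambda>n. ennreal (1 / real (Suc n))) \<longlonglongrightarrow> ennreal 0"
      using LIMSEQ_inverse_real_of_nat by (intro tendsto_ennrealI) (simp add: inverse_eq_divide)
    ultimately have "emeasure lebesgue (D - S) \<le> ennreal 0"
      by (intro LIMSEQ_le_const) auto
    then show ?thesis using mD mS by (auto simp: null_sets_def)
  qed
  then have "AE x in lebesgue. x \<notin> D - S" by (rule AE_not_in)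
  then have DS: "AE x in lebesgue. x \<in> D \<longleftrightarrow> x \<in> S" 
    by eventually_elim (use SW in \<open>auto simp: D_def\<close>)
  have fS: "set_integrable lebesgue S f" using mS by (intro fs) (auto simp: S_def)
  have fD: "set_integrable lebesgue D f" using W(2)[of 0] by (intro fs mD) (auto simp: D_def)
  have "set_lebesgue_integral lebesgue S f = set_lebesgue_integral lebesgue D f"
    unfolding set_lebesgue_integral_def
    using fS fD DS by (intro integral_cong_AE) (auto simp: set_integrable_def indicator_def elim!: eventually_mono)
  then have "set_lebesgue_integral lebesgue S f \<le> 0" using D0 by simp
  moreover have nn: "indicator S x *\<^sub>R f x \<ge> 0" for x by (auto simp: S_def indicator_def)
  ultimately have "integral\<^sup>L lebesgue (\<lambda>x. indicator S x *\<^sub>R f x) = 0"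
    unfolding set_lebesgue_integral_def by (intro antisym integral_nonneg_AE) auto
  then have "AE x in lebesgue. indicator S x *\<^sub>R f x = 0"
    using integral_nonneg_eq_0_iff_AE[of lebesgue "\<lambda>x. indicator S x *\<^sub>R f x"] fS nn
    by (simp add: set_integrable_def)
  then have "AE x in lebesgue. x \<in> {a<..<b} - U \<longrightarrow> f x \<le> 0"
    by eventually_elim (auto simp: S_def indicator_def split: if_splits)
  then show thesis using that[of U] opU Uab U0 by blast
qed

section \<open>Comparison of averages over a window of values\<close>

text \<open>For \<open>C \<bullet> u < P \<bullet> u\<close>, \<open>k C P w\<close> is a positive
  multiple of the height of \<open>w\<close> above the line through \<open>C\<close> and
  \<open>P\<close>. A convex graph lies below its chord between the ends and above the line outside;
  the cases are the chord inequality with \<open>w\<close> in the middle, on the left and on the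
  right.\<close>

lemma chord_determinant:
  fixes \<Gamma> :: "'a::real_inner set" and u e :: 'a
  defines "k \<equiv> \<lambda>C P w. (w \<bullet> e - C \<bullet> e) * (P \<bullet> u - C \<bullet> u) - (P \<bullet> e - C \<bullet> e) * (w \<bullet> u - C \<bullet> u)"
  assumes supp: "\<And>w. w \<in> \<Gamma> \<Longrightarrow> \<exists>\<sigma>. \<forall>z \<in> \<Gamma>. z \<bullet> e \<ge> w \<bullet> e + \<sigma> * (z \<bullet> u - w \<bullet> u)"
    and CPw: "C \<in> \<Gamma>" "P \<in> \<Gamma>" "w \<in> \<Gamma>" "C \<bullet> u \<le> P \<bullet> u"
  shows "C \<bullet> u \<le> w \<bullet> u \<Longrightarrow> w \<bullet> u \<le> P \<bullet> u \<Longrightarrow> k C P w \<le> 0"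
    and "w \<bullet> u \<le> C \<bullet> u \<or> P \<bullet> u \<le> w \<bullet> u \<Longrightarrow> k C P w \<ge> 0"
proof -
  show "k C P w \<le> 0" if "C \<bullet> u \<le> w \<bullet> u" "w \<bullet> u \<le> P \<bullet> u"
    using chord_inequality[OF supp CPw(1,3,2) that] by (simp add: k_def)
  have "k C P w \<ge> 0" if "w \<bullet> u \<le> C \<bullet> u"
    using chord_inequality[OF supp CPw(3,1,2) that CPw(4)] by (simp add: k_def algebra_simps)
  moreover have "k C P w \<ge> 0" if "P \<bullet> u \<le> w \<bullet> u"
    using chord_inequality[OF supp CPw(1,2,3) CPw(4) that] by (simp add: k_def algebra_simps)
  ultimately show "w \<bullet> u \<le> C \<bullet> u \<or> P \<bullet> u \<le> w \<bullet> u \<Longrightarrow> k C P w \<ge> 0" by blast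
qed

lemma integrable_equidistributed:
  fixes \<phi> \<psi> :: "'a \<Rightarrow> 'v::euclidean_space" and g :: "'v \<Rightarrow> real"
  assumes "\<phi> \<in> borel_measurable M" "\<psi> \<in> borel_measurable M"
    and "distr M borel \<phi> = distr M borel \<psi>" and "g \<in> borel_measurable borel"
  shows "integrable M (\<lambda>t. g (\<phi> t)) \<longleftrightarrow> integrable M (\<lambda>t. g (\<psi> t))"
    and "(LINT t|M. g (\<phi> t)) = (LINT t|M. g (\<psi> t))"
  using assms by (simp_all flip: integrable_distr_eq integral_distr)

text \<open>\<open>E\<close> stands for the rising sun set. Since \<open>k P\<close> is affine, its
  integral over \<open>J\<close> is determined by \<open>measure M J\<close> and \<open>z\<close>,
  while its integral over \<open>E\<close> involves the mean of \<open>\<phi> \<bullet> e\<close>.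
  Equidistribution carries integrals over sets of values from \<open>\<psi>\<close> to
  \<open>\<phi>\<close>, and the signs of \<open>k P\<close> relate these sets to \<open>J\<close>
  and \<open>E\<close>.\<close>

lemma window_comparison:
  fixes \<phi> \<psi> :: "'a \<Rightarrow> 'v::euclidean_space"
  assumes "finite_measure M" and \<phi>: "integrable M \<phi>" and \<psi>: "integrable M \<psi>"
    and eq: "distr M borel \<phi> = distr M borel \<psi>"
    and \<Gamma>: "\<And>t. t \<in> space M \<Longrightarrow> \<phi> t \<in> \<Gamma> \<and> \<psi> t \<in> \<Gamma>"
    and supp: "\<And>w. w \<in> \<Gamma> \<Longrightarrow> \<exists>\<sigma>. \<forall>z \<in> \<Gamma>. z \<bullet> e \<ge> w \<bullet> e + \<sigma> * (z \<bullet> u - w \<bullet> u)"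
    and inj: "inj_on (\<lambda>w. w \<bullet> u) \<Gamma>"
    and J: "J \<in> sets M" "measure M J > 0" "(LINT t:J|M. \<psi> t) = measure M J *\<^sub>R z"
    and E: "E \<in> sets M" "(LINT t:E|M. \<phi> t \<bullet> u) = measure M E * (z \<bullet> u)"
    and up: "AE t in M. z \<bullet> u < \<phi> t \<bullet> u \<longrightarrow> t \<in> E"
    and A: "A \<in> \<Gamma>" "A \<bullet> u = z \<bullet> u" "A \<bullet> e < z \<bullet> e"
    and CD: "C \<in> \<Gamma>" "D \<in> \<Gamma>"
    and window: "AE t in M. t \<in> J \<longrightarrow> C \<bullet> u \<le> \<psi> t \<bullet> u \<and> \<psi> t \<bullet> u \<le> D \<bullet> u"
      "AE t in M. t \<notin> J \<longrightarrow> \<psi> t \<bullet> u \<le> C \<bullet> u \<or> D \<bullet> u \<le> \<psi> t \<bullet> u"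
  shows "measure M E > 0 \<and> measure M E * (z \<bullet> e) \<le> (LINT t:E|M. \<phi> t \<bullet> e)"
proof -
  interpret finite_measure M by fact
  have [measurable]: "\<phi> \<in> borel_measurable M" "\<psi> \<in> borel_measurable M" "J \<in> sets M" "E \<in> sets M"
    using \<phi> \<psi> J E by auto
  have si: "set_integrable M B (\<lambda>t. \<phi> t \<bullet> v)" "set_integrable M B (\<lambda>t. \<psi> t \<bullet> v)"
    "set_integrable M B (\<lambda>t. c)" if "B \<in> sets M" for B v and c :: real
    unfolding set_integrable_def
    by (intro integrable_mult_indicator integrable_inner_left integrable_const \<phi> \<psi> that)+
  have const: "(LINT t:B|M. c) = measure M B * c" if "B \<in> sets M" for B and c :: real
    using that by (simp add: set_integral_const)
  have JI: "(LINT t:J|M. \<psi> t \<bullet> v) = measure M J * (z \<bullet> v)" for v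
  proof -
    have "(LINT t:J|M. \<psi> t \<bullet> v) = (LINT t:J|M. \<psi> t) \<bullet> v"
      unfolding set_lebesgue_integral_def
      using \<psi> J by (subst integral_inner_left[symmetric]) (auto intro: integrable_mult_indicator)
    then show ?thesis using J(3) by simp
  qed
  \<comment> \<open>The mean of \<open>\<psi> \<bullet> u\<close> over \<open>J\<close> is
    \<open>z \<bullet> u\<close>, so a deviation of constant sign vanishes almost everywhere on
    \<open>J\<close>. Injectivity then forces \<open>\<psi> = A\<close> there, whence
    \<open>z = A\<close>, although \<open>A\<close> lies strictly below \<open>z\<close>.\<close>
  have strict: False if s: "AE t in M. t \<in> J \<longrightarrow> s * (\<psi> t \<bullet> u - z \<bullet> u) \<ge> 0" and s0: "s \<noteq> 0" for s :: real
  proof -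
    let ?g = "\<lambda>t. indicator J t *\<^sub>R (s * (\<psi> t \<bullet> u - z \<bullet> u))"
    have gi: "integrable M ?g" 
      using si(2,3)[OF J(1)] by (simp add: set_integrable_def right_diff_distrib mult.left_commute[of _ s])
    have "(LINT t:J|M. \<psi> t \<bullet> u - z \<bullet> u) = 0"
      using si[OF J(1)] const[OF J(1)] JI by simp
    then have "integral\<^sup>L M ?g = 0"
      by (simp add: set_lebesgue_integral_def mult.left_commute[of _ s])
    moreover have "AE t in M. ?g t \<ge> 0" using s by eventually_elim (auto simp: indicator_def)
    ultimately have "AE t in M. ?g t = 0" using integral_nonneg_eq_0_iff_AE[OF gi] by simp
    then have "AE t in M. t \<in> space M \<and> ?g t = 0" by (intro AE_conjI AE_space)
    then have "AE t in M. indicator J t *\<^sub>R \<psi> t = indicator J t *\<^sub>R A"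
    proof eventually_elim
      case (elim t)
      show ?case
      proof (cases "t \<in> J")
        case True
        then have "\<psi> t \<bullet> u = A \<bullet> u" using elim s0 A by simp
        then have "\<psi> t = A" using \<Gamma> elim A by (intro inj_onD[OF inj]) auto
        then show ?thesis by simp
      qed simp
    qed
    then have "(LINT t:J|M. \<psi> t) = (LINT t:J|M. A)"
      unfolding set_lebesgue_integral_def by (intro integral_cong_AE) auto
    also have "\<dots> = measure M J *\<^sub>R A" using J(1) by (simp add: set_integral_const)
    finally have "z = A" using J by simp
    then show False using A by simp
  qed
  have Cz: "C \<bullet> u < z \<bullet> u"
  proof (rule ccontr)
    assume n: "\<not> C \<bullet> u < z \<bullet> u"
    show False by (rule strict[of 1]) (use window(1) n in \<open>auto elim!: eventually_mono\<close>)
  qed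
  have Dz: "z \<bullet> u < D \<bullet> u"
  proof (rule ccontr)
    assume n: "\<not> z \<bullet> u < D \<bullet> u"
    show False by (rule strict[of "-1"]) (use window(1) n in \<open>auto elim!: eventually_mono\<close>)
  qed
  define k where "k P w = (w \<bullet> e - C \<bullet> e) * (P \<bullet> u - C \<bullet> u) - (P \<bullet> e - C \<bullet> e) * (w \<bullet> u - C \<bullet> u)" for P w
  have kin: "k P w \<le> 0" if "P \<in> \<Gamma>" "w \<in> \<Gamma>" "C \<bullet> u \<le> P \<bullet> u" "C \<bullet> u \<le> w \<bullet> u" "w \<bullet> u \<le> P \<bullet> u" for P w
    unfolding k_def using chord_determinant(1)[OF supp CD(1) that] .
  have kout: "k P w \<ge> 0" if "P \<in> \<Gamma>" "w \<in> \<Gamma>" "C \<bullet> u \<le> P \<bullet> u" "w \<bullet> u \<le> C \<bullet> u \<or> P \<bullet> u \<le> w \<bullet> u" for P w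
    unfolding k_def using chord_determinant(2)[OF supp CD(1) that] .
  have [measurable]: "k P \<in> borel_measurable borel" for P unfolding k_def by measurable
  have ki: "set_integrable M B (\<lambda>t. k P (\<phi> t))" "set_integrable M B (\<lambda>t. k P (\<psi> t))"
    if "B \<in> sets M" for B P unfolding k_def using si[OF that] by auto
  have kE: "(LINT t:E|M. k P (\<phi> t)) = measure M E * k P z
      + (P \<bullet> u - C \<bullet> u) * ((LINT t:E|M. \<phi> t \<bullet> e) - measure M E * (z \<bullet> e))" for P
    unfolding k_def using si[OF E(1)] const[OF E(1)] E(2) by (simp add: algebra_simps)
  have kJ: "(LINT t:J|M. k P (\<psi> t)) = measure M J * k P z" for P
    unfolding k_def using si[OF J(1)] const[OF J(1)] JI by (simp add: algebra_simps)
  \<comment> \<open>\<open>Q\<close> is a set of values, so integrating \<open>k P\<close> over the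
    points with values in \<open>Q\<close> gives the same for \<open>\<phi>\<close> and
    \<open>\<psi>\<close>. The two almost everywhere bounds compare this with \<open>J\<close> and
    with \<open>E\<close>.\<close>
  have transfer: "measure M J * k P z \<le> (LINT t:E|M. k P (\<phi> t))"
    if [measurable]: "Q \<in> sets borel"
      and 1: "AE t in M. indicator Q (\<phi> t) * k P (\<phi> t) \<le> indicator E t * k P (\<phi> t)"
      and 2: "AE t in M. indicator J t * k P (\<psi> t) \<le> indicator Q (\<psi> t) * k P (\<psi> t)" for Q P
  proof -
    have int: "integrable M (\<lambda>t. indicator Q (f t) * k P (f t))" "integrable M (\<lambda>t. k P (f t))"
      if "f = \<phi> \<or> f = \<psi>" for f
    proof -
      show *: "integrable M (\<lambda>t. k P (f t))"
        unfolding k_def using \<phi> \<psi> that by auto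
      have [measurable]: "f \<in> borel_measurable M" using that by auto
      show "integrable M (\<lambda>t. indicator Q (f t) * k P (f t))"
        by (rule Bochner_Integration.integrable_bound[OF *]) (auto simp: indicator_def)
    qed
    have "measure M J * k P z = (LINT t|M. indicator J t * k P (\<psi> t))"
      using kJ[of P] by (simp add: set_lebesgue_integral_def)
    also have "\<dots> \<le> (LINT t|M. indicator Q (\<psi> t) * k P (\<psi> t))"
      using ki(2)[OF J(1)] by (intro integral_mono_AE int 2) (auto simp: set_integrable_def)
    also have "\<dots> = (LINT t|M. indicator Q (\<phi> t) * k P (\<phi> t))"
      using integrable_equidistributed(2)[OF _ _ eq, of "\<lambda>w. indicator Q w * k P w"] by simp
    also have "\<dots> \<le> (LINT t|M. indicator E t * k P (\<phi> t))"
      using ki(1)[OF E(1)] by (intro integral_mono_AE int 1) (auto simp: set_integrable_def)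
    finally show ?thesis by (simp add: set_lebesgue_integral_def)
  qed
  have space: "AE t in M. t \<in> space M" by (rule AE_space)
  \<comment> \<open>\<open>k P\<close> is the affine function vanishing at \<open>C\<close> and \<open>P\<close>. If \<open>E\<close> is at least as large as \<open>J\<close>,
    take the chord across the whole window, where \<open>k D z \<le> 0\<close>; otherwise take the chord ending at
    \<open>A\<close>, where \<open>k A z > 0\<close>. In both cases normalisation by the measures goes the right way.\<close>
  show ?thesis
  proof (cases "measure M J \<le> measure M E")
    case True
    have CuD: "C \<bullet> u \<le> D \<bullet> u" using Cz Dz by simp
    \<comment> \<open>On the window \<open>k D\<close> is nonpositive and off it nonnegative, so no
      set can give a smaller integral than the points with values in \<open>?Q\<close>. Up to null
      sets \<open>\<psi>\<close> takes such values only on \<open>J\<close>.\<close>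
    let ?Q = "{w. C \<bullet> u < w \<bullet> u \<and> w \<bullet> u < D \<bullet> u}"
    have "measure M J * k D z \<le> (LINT t:E|M. k D (\<phi> t))"
    proof (rule transfer[of ?Q])
      show "AE t in M. indicator ?Q (\<phi> t) * k D (\<phi> t) \<le> indicator E t * k D (\<phi> t)"
        using space
      proof eventually_elim
        case (elim t)
        then show ?case using kin[of D "\<phi> t"] kout[of D "\<phi> t"] CD CuD \<Gamma>
          by (cases "\<phi> t \<in> ?Q"; cases "t \<in> E") (auto simp: not_less)
      qed
      show "AE t in M. indicator J t * k D (\<psi> t) \<le> indicator ?Q (\<psi> t) * k D (\<psi> t)"
        using space window
      proof eventually_elim
        case (elim t)
        then show ?case using kin[of D "\<psi> t"] CD CuD \<Gamma>
          by (cases "\<psi> t \<in> ?Q"; cases "t \<in> J") (auto simp: not_less)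
      qed
    qed measurable
    \<comment> \<open>On \<open>J\<close> the values of \<open>\<psi>\<close> lie below the chord,
      hence so does their average.\<close>
    moreover have "k D z \<le> 0"
    proof -
      have "(LINT t:J|M. k D (\<psi> t)) \<le> (LINT t:J|M. 0)"
      proof (rule set_integral_mono_AE)
        show "AE t\<in>J in M. k D (\<psi> t) \<le> 0"
          using space window(1) by eventually_elim (use kin CD CuD \<Gamma> in auto)
      qed (use ki si J in auto)
      then show ?thesis using J(2) kJ[of D] by (simp add: mult_le_0_iff)
    qed
    then have "(measure M J - measure M E) * k D z \<ge> 0" using True by (intro mult_nonpos_nonpos) auto
    ultimately have "(D \<bullet> u - C \<bullet> u) * ((LINT t:E|M. \<phi> t \<bullet> e) - measure M E * (z \<bullet> e)) \<ge> 0"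
      using kE[of D] by (simp add: algebra_simps)
    then show ?thesis using Cz Dz True J(2) by (simp add: zero_le_mult_iff)
  next
    case False
    have CuA: "C \<bullet> u \<le> A \<bullet> u" using Cz A by simp
    \<comment> \<open>Values above the window are included, since \<open>k A\<close> is nonnegative
      beyond \<open>A\<close>. Points where \<open>\<phi>\<close> lies beyond \<open>A\<close> are
      in \<open>E\<close> by \<open>up\<close>; between \<open>C\<close> and \<open>A\<close> the
      sign of \<open>k A\<close> permits dropping points.\<close>
    let ?Q = "{w. C \<bullet> u < w \<bullet> u}"
    have le: "measure M J * k A z \<le> (LINT t:E|M. k A (\<phi> t))"
    proof (rule transfer[of ?Q])
      show "AE t in M. indicator ?Q (\<phi> t) * k A (\<phi> t) \<le> indicator E t * k A (\<phi> t)"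
        using space up
      proof eventually_elim
        case (elim t)
        then show ?case using kin[of A "\<phi> t"] kout[of A "\<phi> t"] A CuA \<Gamma>
          by (cases "\<phi> t \<in> ?Q"; cases "t \<in> E") (auto simp: not_less)
      qed
      show "AE t in M. indicator J t * k A (\<psi> t) \<le> indicator ?Q (\<psi> t) * k A (\<psi> t)"
        using space window
      proof eventually_elim
        case (elim t)
        then show ?case using kin[of A "\<psi> t"] kout[of A "\<psi> t"] A CuA Dz \<Gamma>
          by (cases "\<psi> t \<in> ?Q"; cases "t \<in> J") (auto simp: not_less)
      qed
    qed measurable
    have "k A z = (A \<bullet> u - C \<bullet> u) * (z \<bullet> e - A \<bullet> e)" using A by (simp add: k_def algebra_simps)
    then have kz: "k A z > 0" using A Cz by simp
    have "0 < (measure M J - measure M E) * k A z" using kz False by simp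
    then have "(A \<bullet> u - C \<bullet> u) * ((LINT t:E|M. \<phi> t \<bullet> e) - measure M E * (z \<bullet> e)) > 0"
      using le kE[of A] by (simp add: algebra_simps)
    then have "(LINT t:E|M. \<phi> t \<bullet> e) - measure M E * (z \<bullet> e) > 0"
      using Cz A by (simp add: zero_less_mult_iff)
    moreover have "measure M E \<noteq> 0"
    proof
      assume 0: "measure M E = 0"
      then have "AE t in M. t \<notin> E" using E(1) by (intro AE_not_in) (auto simp: null_sets_def emeasure_eq_measure)
      then have "(LINT t:E|M. k A (\<phi> t)) = (LINT t|M. 0)"
        unfolding set_lebesgue_integral_def
        by (intro integral_cong_AE) (auto elim!: eventually_mono)
      then show False using le kz J(2) by (simp add: mult_le_0_iff)
    qed
    ultimately show ?thesis using measure_nonneg[of M E] by linarith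
  qed
qed

lemma set_lebesgue_integral_lebesgue_on:
  fixes g :: "'a::euclidean_space \<Rightarrow> 'b::{banach, second_countable_topology}"
  assumes "I \<in> sets lebesgue" "E \<subseteq> I"
  shows "(LINT t:E|lebesgue_on I. g t) = (LINT t:E|lebesgue. g t)"
proof -
  have *: "indicator I t *\<^sub>R indicator E t *\<^sub>R g t = indicator E t *\<^sub>R g t" for t
    using assms(2) by (auto simp: indicator_def)
  show ?thesis
    unfolding set_lebesgue_integral_def using assms(1)
    by (subst integral_restrict_space) (simp_all add: * del: scaleR_scaleR)
qed

text \<open>The average of \<open>\<phi>\<close> over each component of the rising sun set has
  projection \<open>z \<bullet> u\<close>. If all these averages avoid \<Omega>1 while
  \<open>z\<close> is in it, they lie below \<open>z\<close> by a uniform margin; so does the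
  average over \<open>U\<close>, against the comparison.\<close>

lemma window_average_avoids:
  fixes I :: "real set" and \<Omega>0 \<Omega>1 :: "(real^2) set" and u e :: "real^2"
  assumes ab: "a < b" and I: "{a<..<b} \<subseteq> I" "I \<subseteq> {a..b}"
    and \<phi>: "\<phi> \<in> A_class I \<Omega>0 \<Omega>1"
    and \<psi>: "\<psi> absolutely_integrable_on I" "\<psi> ` I \<subseteq> frontier \<Omega>0"
    and eq: "distr (lebesgue_on I) borel \<phi> = distr (lebesgue_on I) borel \<psi>"
    and supp: "\<And>w. w \<in> frontier \<Omega>0 \<Longrightarrow>
      \<exists>\<sigma>. \<forall>z \<in> frontier \<Omega>0. z \<bullet> e \<ge> w \<bullet> e + \<sigma> * (z \<bullet> u - w \<bullet> u)"
    and inj: "inj_on (\<lambda>w. w \<bullet> u) (frontier \<Omega>0)"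
    and ue: "norm u = 1" "norm e = 1" "e \<bullet> u = 0"
    and up1: "\<And>w t. w \<in> \<Omega>1 \<Longrightarrow> t \<ge> 0 \<Longrightarrow> w + t *\<^sub>R e \<in> \<Omega>1" and op1: "open \<Omega>1"
    and A: "A \<in> frontier \<Omega>0" "A \<bullet> u = z \<bullet> u" "A \<bullet> e < z \<bullet> e"
    and J: "J \<in> sets lebesgue" "J \<subseteq> I" "measure lebesgue J > 0"
      "(LINT t:J|lebesgue. \<psi> t) = measure lebesgue J *\<^sub>R z"
    and CD: "C \<in> frontier \<Omega>0" "D \<in> frontier \<Omega>0"
    and window: "AE t in lebesgue_on I. t \<in> J \<longrightarrow> C \<bullet> u \<le> \<psi> t \<bullet> u \<and> \<psi> t \<bullet> u \<le> D \<bullet> u"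
      "AE t in lebesgue_on I. t \<notin> J \<longrightarrow> \<psi> t \<bullet> u \<le> C \<bullet> u \<or> D \<bullet> u \<le> \<psi> t \<bullet> u"
    and mean: "(LINT t:I|lebesgue. \<phi> t \<bullet> u) \<le> (b - a) * (z \<bullet> u)"
  shows "z \<notin> \<Omega>1"
proof
  assume z: "z \<in> \<Omega>1"
  have mI: "I \<in> sets lebesgue" by (rule sets_lebesgue_between[OF I])
  have \<phi>I: "\<phi> absolutely_integrable_on I" and \<phi>\<Gamma>: "\<phi> ` I \<subseteq> frontier \<Omega>0"
    and \<phi>avg: "\<And>J. bounded_interval J \<Longrightarrow> J \<subseteq> I \<Longrightarrow> average J \<phi> \<notin> \<Omega>1"
    using \<phi> by (auto simp: A_class_def)
  have nab: "negligible {a, b}" by simp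
  have Idiff: "I - {a..b} \<subseteq> {a, b}" "{a..b} - I \<subseteq> {a, b}" using I by (fastforce simp: subset_eq)+
  have \<phi>ab: "\<phi> absolutely_integrable_on {a..b}"
    by (rule absolutely_integrable_between[OF \<phi>I I])
  have si: "set_integrable lebesgue B (\<lambda>t. \<phi> t \<bullet> v - c)" "set_integrable lebesgue B (\<lambda>t. \<phi> t \<bullet> v)"
    "set_integrable lebesgue B (\<lambda>t. c)" "set_integrable lebesgue B \<phi>"
    if "B \<in> sets lebesgue" "B \<subseteq> {a..b}" for B v and c :: real
  proof -
    have B: "B \<in> lmeasurable" 
      by (rule bounded_set_imp_lmeasurable[OF bounded_subset[OF bounded_closed_interval that(2)] that(1)])
    show 4: "set_integrable lebesgue B \<phi>" using that by (intro set_integrable_subset[OF \<phi>ab]) auto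
    then have "integrable lebesgue (\<lambda>t. (indicator B t *\<^sub>R \<phi> t) \<bullet> v)"
      unfolding set_integrable_def by (rule integrable_inner_left)
    then show 2: "set_integrable lebesgue B (\<lambda>t. \<phi> t \<bullet> v)"
      by (simp add: set_integrable_def)
    show 3: "set_integrable lebesgue B (\<lambda>t. c)"
      unfolding set_integrable_def using B by (auto simp: fmeasurable_def)
    show "set_integrable lebesgue B (\<lambda>t. \<phi> t \<bullet> v - c)" using 2 3 by (rule set_integral_diff)
  qed
  have inner: "(LINT t:B|lebesgue. \<phi> t \<bullet> v) = (LINT t:B|lebesgue. \<phi> t) \<bullet> v"
    if "B \<in> sets lebesgue" "B \<subseteq> {a..b}" for B v
    unfolding set_lebesgue_integral_def
    using si(4)[OF that] by (subst integral_inner_left[symmetric]) (auto simp: set_integrable_def)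
  have diff: "(LINT t:B|lebesgue. \<phi> t \<bullet> v - c) = (LINT t:B|lebesgue. \<phi> t \<bullet> v) - measure lebesgue B * c"
    if "B \<in> sets lebesgue" "B \<subseteq> {a..b}" for B v and c :: real
  proof -
    have "B \<in> lmeasurable" 
      by (rule bounded_set_imp_lmeasurable[OF bounded_subset[OF bounded_closed_interval that(2)] that(1)])
    then have "(LINT t:B|lebesgue. c) = measure lebesgue B * c"
      by (subst set_integral_const) (auto simp: fmeasurable_def)
    then show ?thesis using si(2,3)[OF that] by simp
  qed
  define f where "f t = \<phi> t \<bullet> u - z \<bullet> u" for t
  have "(LINT t:I|lebesgue. \<phi> t \<bullet> u) = (LINT t:{a..b}|lebesgue. \<phi> t \<bullet> u)"
  proof -
    have "AE t in lebesgue. t \<notin> {a, b}" using nab by (intro AE_not_in) (simp add: negligible_iff_null_sets)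
    then have "AE t in lebesgue. t \<in> I \<longleftrightarrow> t \<in> {a..b}"
      by eventually_elim (use Idiff in auto)
    then show ?thesis using si(2)[OF mI I(2)] si(2)[of "{a..b}"]
      unfolding set_lebesgue_integral_def set_integrable_def
      by (intro integral_cong_AE) (auto simp: indicator_def elim!: eventually_mono)
  qed
  then have f0: "(LINT t:{a..b}|lebesgue. f t) \<le> 0"
    unfolding f_def using mean diff[of "{a..b}" u] ab by simp
  have fab: "f absolutely_integrable_on {a..b}" unfolding f_def by (intro si) auto
  obtain U where U: "open U" "U \<subseteq> {a<..<b}"
    "\<forall>p q. p < q \<and> {p<..<q} \<subseteq> U \<and> p \<notin> U \<and> q \<notin> U \<longrightarrow> (LINT x:{p<..<q}|lebesgue. f x) = 0"
    "AE x in lebesgue. x \<in> {a<..<b} - U \<longrightarrow> f x \<le> 0"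
    using rising_sun[OF fab ab f0] .
  have Uab: "U \<subseteq> {a..b}" and UI: "U \<subseteq> I" and mU: "U \<in> sets lebesgue" and bU: "bounded U"
    using U(1,2) I bounded_subset[OF _ U(2)] by (auto simp: subset_eq)
  have fU: "set_integrable lebesgue U f" unfolding f_def using mU Uab by (rule si)
  have U3: "(LINT x:{p<..<q}|lebesgue. f x) = 0"
    if "p < q" "{p<..<q} \<subseteq> U" "p \<notin> U" "q \<notin> U" for p q
    by (rule U(3)[rule_format]) (intro conjI that)
  \<comment> \<open>Using the one-sided bound for \<open>f\<close> and for \<open>- f\<close> gives
    the exact mean over \<open>U\<close>.\<close>
  have "(LINT t:U|lebesgue. f t) \<le> 0"
    by (rule set_integral_open_nonpos[OF U(1) bU fU]) (rule eq_refl, rule U3)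
  moreover have "(LINT t:U|lebesgue. - f t) \<le> 0"
  proof (rule set_integral_open_nonpos[OF U(1) bU])
    show "set_integrable lebesgue U (\<lambda>x. - f x)" using fU by (simp add: set_integrable_def)
    show "(LINT x:{p<..<q}|lebesgue. - f x) \<le> 0"
      if "p < q" "{p<..<q} \<subseteq> U" "p \<notin> U" "q \<notin> U" for p q
      using U3[OF that] by (simp add: set_lebesgue_integral_def)
  qed
  ultimately have "(LINT t:U|lebesgue. f t) = 0" using fU by (simp add: set_integral_uminus)
  then have Umean: "(LINT t:U|lebesgue. \<phi> t \<bullet> u) = measure lebesgue U * (z \<bullet> u)"
    unfolding f_def diff[OF mU Uab] by simp
  let ?M = "lebesgue_on I"
  have meas: "measure ?M B = measure lebesgue B" if "B \<in> sets lebesgue" "B \<subseteq> I" for B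
    using that mI by (intro measure_restrict_space) auto
  have setsM: "B \<in> sets ?M" if "B \<in> sets lebesgue" "B \<subseteq> I" for B
    using that mI by (simp add: sets_restrict_space_iff)
  have intM: "integrable ?M f" if "f absolutely_integrable_on I" for f :: "real \<Rightarrow> real^2"
    using that mI by (simp add: integrable_restrict_space set_integrable_def)
  have "I \<in> lmeasurable" 
    by (rule bounded_set_imp_lmeasurable[OF bounded_subset[OF bounded_closed_interval I(2)] mI])
  then have fin: "finite_measure ?M" by (rule finite_measure_lebesgue_on)
  have "measure ?M U > 0 \<and> measure ?M U * (z \<bullet> e) \<le> (LINT t:U|?M. \<phi> t \<bullet> e)"
  proof (rule window_comparison[where \<Gamma> = "frontier \<Omega>0" and \<psi> = \<psi> and u = u and J = J and A = A
        and C = C and D = D])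
    show "\<phi> t \<in> frontier \<Omega>0 \<and> \<psi> t \<in> frontier \<Omega>0" if "t \<in> space ?M" for t
      using that \<phi>\<Gamma> \<psi>(2) by (auto simp: space_restrict_space)
    show "AE t in ?M. z \<bullet> u < \<phi> t \<bullet> u \<longrightarrow> t \<in> U"
    proof -
      have "AE t in lebesgue. t \<notin> {a, b}" using nab by (intro AE_not_in) (simp add: negligible_iff_null_sets)
      then have "AE t in lebesgue. t \<in> I \<longrightarrow> z \<bullet> u < \<phi> t \<bullet> u \<longrightarrow> t \<in> U"
        using U(4) by eventually_elim (use I(2) in \<open>auto simp: f_def subset_eq\<close>)
      then show ?thesis using mI by (simp add: AE_restrict_space_iff)
    qed
    show "(LINT t:J|?M. \<psi> t) = measure ?M J *\<^sub>R z"
      using J mI by (simp add: set_lebesgue_integral_lebesgue_on meas)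
    show "(LINT t:U|?M. \<phi> t \<bullet> u) = measure ?M U * (z \<bullet> u)"
      using Umean mI UI mU by (simp add: set_lebesgue_integral_lebesgue_on meas)
    show "0 < measure ?M J" using J by (simp add: meas)
  qed (fact fin eq supp inj A CD window | intro setsM intM mU UI J \<phi>I \<psi>)+
  then have pos: "measure lebesgue U > 0"
    and ge: "measure lebesgue U * (z \<bullet> e) \<le> (LINT t:U|lebesgue. \<phi> t \<bullet> e)"
    using mI UI mU by (simp_all add: set_lebesgue_integral_lebesgue_on meas)
  \<comment> \<open>\<open>\<delta>\<close> is room below \<open>z\<close> inside \<Omega>1; it
    supplies the strictness that contradicts the non-strict bound \<open>ge\<close>.\<close>
  obtain \<delta> where \<delta>: "\<delta> > 0" "z - \<delta> *\<^sub>R e \<in> \<Omega>1"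
  proof -
    obtain r where r: "r > 0" "ball z r \<subseteq> \<Omega>1" using op1 z open_contains_ball by metis
    have "z - (r/2) *\<^sub>R e \<in> ball z r" using r ue(2) by (simp add: dist_norm)
    then show thesis using r by (intro that[of "r/2"]) auto
  qed
  have "(LINT t:U|lebesgue. \<phi> t \<bullet> e - (z \<bullet> e - \<delta>)) \<le> 0"
  proof (rule set_integral_open_nonpos[OF U(1) bU])
    show "set_integrable lebesgue U (\<lambda>t. \<phi> t \<bullet> e - (z \<bullet> e - \<delta>))" using mU Uab by (rule si)
    fix p q assume pq: "p < q" "{p<..<q} \<subseteq> U" "p \<notin> U" "q \<notin> U"
    have B: "{p<..<q} \<in> sets lebesgue" "{p<..<q} \<subseteq> {a..b}" "{p<..<q} \<subseteq> I" using pq Uab UI by auto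
    have mB: "measure lebesgue {p<..<q} = q - p" using pq by simp
    define v where "v = average {p<..<q} \<phi>"
    have v: "(LINT t:{p<..<q}|lebesgue. \<phi> t) = (q - p) *\<^sub>R v"
      using pq mB by (simp add: v_def average_def)
    have "bounded_interval {p<..<q}"
      using pq(1) by (simp add: bounded_interval_def is_interval_oo interior_open)
    then have vn: "v \<notin> \<Omega>1" unfolding v_def using B by (intro \<phi>avg) auto
    have "(q - p) * (v \<bullet> u - z \<bullet> u) = 0"
      using U3[OF pq, unfolded f_def]
      unfolding diff[OF B(1,2)] inner[OF B(1,2)] v mB by (simp add: algebra_simps)
    then have vu: "v \<bullet> u = z \<bullet> u" using pq by simp
    \<comment> \<open>A higher \<open>v\<close> would be an upward translate of
      \<open>z - \<delta> *\<^sub>R e\<close>, as both have projection \<open>z \<bullet> u\<close>,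
      and so would lie in \<Omega>1.\<close>
    have "v \<bullet> e \<le> z \<bullet> e - \<delta>"
    proof (rule ccontr)
      assume "\<not> v \<bullet> e \<le> z \<bullet> e - \<delta>"
      then have "z - \<delta> *\<^sub>R e + (v \<bullet> e - (z \<bullet> e - \<delta>)) *\<^sub>R e \<in> \<Omega>1" by (intro up1 \<delta>) auto
      moreover have "z - \<delta> *\<^sub>R e + (v \<bullet> e - (z \<bullet> e - \<delta>)) *\<^sub>R e = v"
      proof -
        have "z - \<delta> *\<^sub>R e + (v \<bullet> e - (z \<bullet> e - \<delta>)) *\<^sub>R e
          = z - (z \<bullet> e) *\<^sub>R e + (v \<bullet> e) *\<^sub>R e" by (simp add: algebra_simps)
        also have "z - (z \<bullet> e) *\<^sub>R e = (v \<bullet> u) *\<^sub>R u"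
          unfolding vu using plane_decomp[OF ue, of z] by (metis add_diff_cancel_right')
        also have "(v \<bullet> u) *\<^sub>R u + (v \<bullet> e) *\<^sub>R e = v" using plane_decomp[OF ue, of v] by simp
        finally show ?thesis .
      qed
      ultimately show False using vn by simp
    qed
    then have "(q - p) * (v \<bullet> e - (z \<bullet> e - \<delta>)) \<le> 0" using pq by (intro mult_nonneg_nonpos) auto
    then show "(LINT t:{p<..<q}|lebesgue. \<phi> t \<bullet> e - (z \<bullet> e - \<delta>)) \<le> 0"
      unfolding diff[OF B(1,2)] inner[OF B(1,2)] v mB by (simp add: algebra_simps)
  qed
  then have "(LINT t:U|lebesgue. \<phi> t \<bullet> e) \<le> measure lebesgue U * (z \<bullet> e - \<delta>)"
    unfolding diff[OF mU Uab] by simp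
  then have "measure lebesgue U * \<delta> \<le> 0" using ge by (simp add: algebra_simps)
  then show False using pos \<delta>(1) by (simp add: mult_le_0_iff)
qed

section \<open>Existence of the non-decreasing rearrangement\<close>

text \<open>A closed set is a countable union of compact sets, whose continuous images are
  compact.\<close>

lemma borel_image_closed:
  fixes g :: "'a::euclidean_space \<Rightarrow> real"
  assumes g: "continuous_on UNIV g" and S: "closed S"
  shows "g ` S \<in> sets borel"
proof -
  have "x \<in> cball 0 (real (nat \<lceil>norm x\<rceil>))" for x :: 'a
    by (simp add: real_nat_ceiling_ge)
  then have "S = (\<Union>n. S \<inter> cball 0 (real n))" by blast
  then have "g ` S = (\<Union>n. g ` (S \<inter> cball 0 (real n)))" by blast
  moreover have "compact (g ` (S \<inter> cball 0 (real n)))" for n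
    using S by (intro compact_continuous_image continuous_on_subset[OF g] closed_Int_compact) auto
  then have "g ` (S \<inter> cball 0 (real n)) \<in> sets borel" for n
    by (intro borel_closed compact_imp_closed)
  ultimately show ?thesis by (auto intro!: sets.countable_UN'')
qed

text \<open>By injectivity the preimage of an open \<open>T\<close> is the complement of the image
  of the closed set \<open>S - T\<close>, up to the points off the range of \<open>g\<close>, where
  the default \<open>c\<close> decides.\<close>

lemma borel_measurable_inv_into_closed:
  fixes g :: "'a::euclidean_space \<Rightarrow> real"
  assumes g: "continuous_on UNIV g" and S: "closed S" and inj: "inj_on g S"
  shows "(\<lambda>y. if y \<in> g ` S then inv_into S g y else c) \<in> borel_measurable borel"
    (is "?h \<in> _")
proof (rule borel_measurableI)
  fix T :: "'a set" assume T: "open T"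
  have gS: "g ` S \<in> sets borel" using g S by (rule borel_image_closed)
  have "?h -` T = UNIV - (g ` (S - T) \<union> (if c \<in> T then {} else - g ` S))"
  proof (rule set_eqI)
    fix y
    show "y \<in> ?h -` T \<longleftrightarrow> y \<in> UNIV - (g ` (S - T) \<union> (if c \<in> T then {} else - g ` S))"
    proof (cases "y \<in> g ` S")
      case True
      then obtain w where w: "w \<in> S" "y = g w" by blast
      then have "y \<in> g ` (S - T) \<longleftrightarrow> w \<notin> T" using inj by (auto dest: inj_onD)
      then show ?thesis using w inj True by simp
    qed auto
  qed
  moreover have "g ` (S - T) \<in> sets borel" using S T by (intro borel_image_closed g closed_Diff)
  moreover have "(if c \<in> T then {} else - g ` S) \<in> sets borel" using gS by auto
  ultimately show "?h -` T \<inter> space borel \<in> sets borel" by auto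
qed

text \<open>The quantile function of \<open>\<phi> \<bullet> u\<close> is nondecreasing and has the
  same distribution as \<open>\<phi> \<bullet> u\<close>. Composing it with the inverse of the
  projection lifts it to the frontier and reproduces the distribution of
  \<open>\<phi>\<close>.\<close>

lemma exists_nondecreasing_rearrangement:
  fixes I :: "real set" and \<Omega>0 :: "(real^2) set" and p u :: "real^2" and \<phi> :: "real \<Rightarrow> real^2"
  assumes ab: "a < b" and I: "{a<..<b} \<subseteq> I" "I \<subseteq> {a..b}"
    and \<phi>: "\<phi> \<in> borel_measurable (lebesgue_on I)" "\<phi> ` I \<subseteq> frontier \<Omega>0"
    and inj: "inj_on (\<lambda>w. w \<bullet> u) (frontier \<Omega>0)"
  shows "\<exists>\<psi>. nondecreasing_rearrangement I \<Omega>0 p u \<phi> \<psi>"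
proof -
  let ?\<Gamma> = "frontier \<Omega>0" and ?M = "lebesgue_on I"
  define P where "P = uniform_measure ?M I"
  have mI: "I \<in> sets lebesgue" by (rule sets_lebesgue_between[OF I])
  have spM: "space ?M = I" by (simp add: space_restrict_space)
  have IM: "I \<in> sets ?M" using mI by (simp add: sets_restrict_space_iff)
  have spP: "space P = I" and setsP: "sets P = sets ?M" by (simp_all add: P_def spM)
  have emI: "emeasure lebesgue I = ennreal (b - a)"
  proof (rule antisym)
    show "emeasure lebesgue I \<le> ennreal (b - a)"
      using emeasure_mono[OF I(2), of lebesgue] ab by simp
    show "ennreal (b - a) \<le> emeasure lebesgue I"
      using emeasure_mono[OF I(1), of lebesgue] ab mI by simp
  qed
  have emIM: "emeasure ?M I = ennreal (b - a)"
    using mI emI by (simp add: emeasure_restrict_space)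
  interpret P: prob_space P
    unfolding P_def by (rule prob_space_uniform_measure) (use emIM ab in auto)
  define X where "X t = \<phi> t \<bullet> u" for t
  have \<phi>P [measurable]: "\<phi> \<in> borel_measurable P"
    using \<phi>(1) by (simp cong: measurable_cong_sets add: setsP)
  have XP [measurable]: "X \<in> borel_measurable P" unfolding X_def by measurable
  define D where "D = distr P borel X"
  interpret D: cdf_distribution D
    unfolding D_def cdf_distribution_def by (rule P.real_distribution_distr) (rule XP)
  have "(a + b) / 2 \<in> I" using I(1) ab by auto
  then obtain c where c: "c \<in> ?\<Gamma>" using \<phi>(2) by blast
  define \<theta> where "\<theta> t = (t - a) / (b - a)" for t
  have \<theta>: "0 < \<theta> t \<and> \<theta> t < 1" if "t \<in> {a<..<b}" for t
    using that by (auto simp: \<theta>_def)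
  \<comment> \<open>the quantile function of \<open>\<phi> \<bullet> u\<close>, rescaled from the unit interval\<close>
  define R where "R t = (if t \<in> {a<..<b} then D.I (\<theta> t) else c \<bullet> u)" for t
  have Rmono: "R s \<le> R t" if "s \<in> {a<..<b}" "t \<in> {a<..<b}" "s \<le> t" for s t
  proof -
    have "\<theta> s \<le> \<theta> t" using that ab by (simp add: \<theta>_def divide_right_mono)
    then show ?thesis using that \<theta> D.mono_I by (auto simp: R_def mono_on_def)
  qed
  have "R \<in> borel_measurable borel"
  proof -
    have "R \<in> borel_measurable (restrict_space borel {a<..<b})"
      using Rmono by (intro borel_measurable_mono_on_fnc) (auto simp: mono_on_def)
    then have "(\<lambda>t. D.I (\<theta> t)) \<in> borel_measurable (restrict_space borel {a<..<b})"
      by (rule measurable_cong[THEN iffD1, rotated]) (simp add: space_restrict_space R_def)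
    then show ?thesis
      unfolding R_def by (subst measurable_If_restrict_space_iff) (simp_all del: greaterThanLessThan_iff)
  qed
  then have "R \<in> borel_measurable ?M" by (intro measurable_restrict_space1 measurable_completion) simp
  then have RP [measurable]: "R \<in> borel_measurable P" by (simp cong: measurable_cong_sets add: setsP)
  have RD: "distr P borel R = D"
  proof (rule cdf_unique)
    show "real_distribution (distr P borel R)" by (rule P.real_distribution_distr) (rule RP)
    show "real_distribution D" by unfold_locales
    show "cdf (distr P borel R) = cdf D"
    proof
      fix x
      have C: "0 \<le> cdf D x" "cdf D x \<le> 1" by (auto simp: D.cdf_nonneg D.cdf_bounded_prob)
      \<comment> \<open>At \<open>r\<close> the rescaled parameter \<open>\<theta>\<close> equals
        \<open>cdf D x\<close>, so inside the interval \<open>R t \<le> x\<close> holds exactly up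
        to \<open>r\<close>.\<close>
      define r where "r = a + (b - a) * cdf D x"
      have "a \<le> r" unfolding r_def using C ab by simp
      moreover have "(b - a) * (1 - cdf D x) \<ge> 0" using C ab by (intro mult_nonneg_nonneg) auto
      then have "r \<le> b" by (simp add: r_def algebra_simps)
      ultimately have rab: "a \<le> r" "r \<le> b" by auto
      have le: "R t \<le> x \<longleftrightarrow> t \<le> r" if "t \<in> {a<..<b}" for t
      proof -
        have "R t \<le> x \<longleftrightarrow> \<theta> t \<le> cdf D x"
          using D.pseudoinverse[of "\<theta> t" x] \<theta>[OF that] that by (simp add: R_def)
        also have "\<dots> \<longleftrightarrow> t \<le> r" using ab by (simp add: \<theta>_def r_def pos_divide_le_eq) (auto simp: algebra_simps)
        finally show ?thesis .
      qed
      let ?B = "R -` {..x} \<inter> I"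
      have BM: "?B \<in> sets ?M"
        using measurable_sets[OF \<open>R \<in> borel_measurable ?M\<close>, of "{..x}"] spM by simp
      then have Bl: "?B \<in> sets lebesgue" using mI by (simp add: sets_restrict_space_iff)
      have "AE t in lebesgue. t \<notin> {a, b}" by (intro AE_not_in) (simp flip: negligible_iff_null_sets)
      then have "AE t in lebesgue. t \<in> ?B \<longleftrightarrow> t \<in> {a..r}"
      proof eventually_elim
        case (elim t)
        show ?case
        proof (cases "t \<in> {a<..<b}")
          case True
          then show ?thesis using le[OF True] I(1) by auto
        next
          case False
          then show ?thesis using elim rab I(2) by (auto simp: subset_eq)
        qed
      qed
      then have "emeasure lebesgue ?B = emeasure lebesgue {a..r}"
        using Bl by (intro emeasure_eq_AE) auto
      then have "measure lebesgue ?B = r - a" using rab by (simp add: measure_def)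
      then have "measure P ?B = (r - a) / (b - a)"
        unfolding P_def using BM IM emIM ab mI Bl emI
        by (subst measure_uniform_measure)
          (auto simp: measure_restrict_space inf.absorb2 measure_def emeasure_restrict_space)
      also have "\<dots> = cdf D x" using ab by (simp add: r_def)
      finally show "cdf (distr P borel R) x = cdf D x"
        by (simp add: cdf_def measure_distr spP)
    qed
  qed
  \<comment> \<open>The default \<open>c\<close> is a frontier point, so the lifted function takes
    values in the frontier everywhere and not just almost everywhere.\<close>
  define h where "h y = (if y \<in> (\<lambda>w. w \<bullet> u) ` ?\<Gamma> then inv_into ?\<Gamma> (\<lambda>w. w \<bullet> u) y else c)" for y
  have hm [measurable]: "h \<in> borel_measurable borel" unfolding h_def
    by (rule borel_measurable_inv_into_closed[OF _ _ inj]) (auto intro: continuous_intros)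
  have h\<Gamma>: "h y \<in> ?\<Gamma>" for y using c by (auto simp: h_def intro: inv_into_into)
  have hX: "h (w \<bullet> u) = w" if "w \<in> ?\<Gamma>" for w
    using that inv_into_f_f[OF inj that] by (auto simp: h_def)
  have hu: "h y \<bullet> u = y" if "y \<in> (\<lambda>w. w \<bullet> u) ` ?\<Gamma>" for y
    using that by (auto simp: hX)
  define \<psi> where "\<psi> t = h (R t)" for t
  have "distr P borel \<psi> = distr (distr P borel R) borel h"
    unfolding \<psi>_def by (subst distr_distr) (auto simp: comp_def)
  also have "\<dots> = distr P borel (\<lambda>t. h (X t))"
    unfolding RD D_def by (subst distr_distr) (auto simp: comp_def)
  also have "\<dots> = distr P borel \<phi>"
    using \<phi>(2) by (intro distr_cong) (auto simp: X_def hX spP image_subset_iff)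
  finally have dist: "distr P borel \<phi> = distr P borel \<psi>" by simp
  have \<psi>m: "\<psi> \<in> borel_measurable ?M"
    unfolding \<psi>_def using \<open>R \<in> borel_measurable ?M\<close> by measurable
  let ?Y = "(\<lambda>w. w \<bullet> u) ` ?\<Gamma>"
  have Y: "?Y \<in> sets borel" by (intro borel_image_closed continuous_intros) auto
  \<comment> \<open>Points where the quantile is no projection of a frontier point, so that
    \<open>h\<close> falls back on \<open>c\<close>, and the endpoints, where \<open>R\<close> has
    its default value. The former are null because \<open>D\<close> is carried by
    \<open>?Y\<close>.\<close>
  define N where "N = {t \<in> I. R t \<notin> ?Y} \<union> {a, b}"
  have "{t \<in> I. R t \<notin> ?Y} \<in> null_sets lebesgue"
  proof -
    have "AE y in D. y \<in> ?Y"
      unfolding D_def using Y \<phi>(2) by (subst AE_distr_iff) (auto simp: X_def spP image_subset_iff)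
    then have "AE t in P. R t \<in> ?Y"
      using Y by (subst (asm) RD[symmetric], subst (asm) AE_distr_iff) auto
    then have "AE t in ?M. R t \<in> ?Y"
      unfolding P_def using emIM ab IM spM
      by (subst (asm) AE_uniform_measure) (auto elim!: AE_mp intro: AE_I2)
    then have "AE t in lebesgue. t \<in> I \<longrightarrow> R t \<in> ?Y" using mI by (simp add: AE_restrict_space_iff)
    then have "AE t in lebesgue. t \<notin> {t \<in> I. R t \<notin> ?Y}" by eventually_elim auto
    moreover have "{t \<in> I. R t \<notin> ?Y} \<in> sets lebesgue"
    proof -
      have "{t \<in> I. R t \<notin> ?Y} = R -` (- ?Y) \<inter> space ?M" using spM by auto
      moreover have "\<dots> \<in> sets ?M"
        using Y by (intro measurable_sets[OF \<open>R \<in> borel_measurable ?M\<close>]) auto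
      ultimately show ?thesis using mI by (simp add: sets_restrict_space_iff)
    qed
    ultimately show ?thesis by (simp add: AE_iff_null_sets)
  qed
  moreover have "{a, b} \<in> null_sets lebesgue" by (simp flip: negligible_iff_null_sets)
  ultimately have N: "N \<in> null_sets lebesgue" unfolding N_def by (rule null_sets.Un)
  have "nondecreasing_on p u (I - N) \<psi>"
    unfolding nondecreasing_on_def mono_on_def proj_line_def
    using I(2) by (auto simp: inner_diff_left \<psi>_def hu N_def subset_eq less_le intro!: Rmono)
  then show ?thesis
    unfolding nondecreasing_rearrangement_def equimeasurable_def
    using h\<Gamma> \<phi>(1) \<psi>m dist N by (intro exI[of _ \<psi>]) (auto simp: \<psi>_def P_def)
qed

section \<open>Averages of the rearrangement\<close>

lemma interval_diff_null_nonempty: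
  fixes c d :: real
  assumes "c < d" "N \<in> null_sets lebesgue"
  obtains t where "c < t" "t < d" "t \<notin> N"
proof -
  have "\<not> {c<..<d} \<subseteq> N"
  proof
    assume "{c<..<d} \<subseteq> N"
    then have "emeasure lebesgue {c<..<d} \<le> emeasure lebesgue N"
      using assms(2) by (intro emeasure_mono) auto
    then show False using assms by (simp add: null_setsD1)
  qed
  then obtain t where "t \<in> {c<..<d}" "t \<notin> N" by blast
  then show thesis using that[of t] by simp
qed

lemma distr_eq_of_uniform_measure:
  assumes M: "finite_measure M" "emeasure M (space M) \<noteq> 0"
    and f [measurable]: "f \<in> measurable M L" and g [measurable]: "g \<in> measurable M L"
    and eq: "distr (uniform_measure M (space M)) L f = distr (uniform_measure M (space M)) L g"
  shows "distr M L f = distr M L g"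
proof (rule measure_eqI)
  interpret finite_measure M by fact
  fix A assume "A \<in> sets (distr M L f)"
  then have A [measurable]: "A \<in> sets L" by simp
  have E: "emeasure (distr (uniform_measure M (space M)) L h) A
      = emeasure (distr M L h) A / emeasure M (space M)" if [measurable]: "h \<in> measurable M L" for h
    by (simp add: emeasure_distr Int_absorb1)
  have "emeasure (distr M L f) A / emeasure M (space M) * emeasure M (space M)
      = emeasure (distr M L g) A / emeasure M (space M) * emeasure M (space M)"
    using E[OF f] E[OF g] eq by simp
  then show "emeasure (distr M L f) A = emeasure (distr M L g) A"
    using M(2) by (simp add: ennreal_divide_times ennreal_divide_self flip: less_top)
qed simp

lemma average_eq_integral:
  assumes f: "f absolutely_integrable_on {a..b}" and "a \<le> p" "p < q" "q \<le> b"
    and J: "{p<..<q} \<subseteq> J" "J \<subseteq> {p..q}"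
  shows "measure lebesgue J = q - p"
    and "average J f = (1 / (q - p)) *\<^sub>R (integral {a..q} f - integral {a..p} f)"
proof -
  have mJ: "J \<in> sets lebesgue" by (rule sets_lebesgue_between[OF J])
  have bdJ: "J \<in> lmeasurable"
    by (rule bounded_set_imp_lmeasurable[OF bounded_subset[OF bounded_closed_interval J(2)] mJ])
  have "measure lebesgue {p<..<q} \<le> measure lebesgue J"
    by (rule measure_mono_fmeasurable[OF J(1) _ bdJ]) simp
  moreover have "measure lebesgue J \<le> measure lebesgue {p..q}"
    by (rule measure_mono_fmeasurable[OF J(2) mJ]) simp
  ultimately show m: "measure lebesgue J = q - p" using assms by simp
  show "average J f = (1 / (q - p)) *\<^sub>R (integral {a..q} f - integral {a..p} f)"
    unfolding average_def m using assms by (subst set_lebesgue_integral_between[OF f _ _ _ J]) auto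
qed

text \<open>The average depends continuously on each endpoint, so the right end and then the left
  end can be moved slightly inwards, off \<open>N\<close>. This supplies endpoints at which
  monotonicity outside a null set can be used.\<close>

lemma shrink_interval:
  assumes f: "f absolutely_integrable_on {a..b}" and pq: "a \<le> p" "p < q" "q \<le> b"
    and S: "open S" "average {p..q} f \<in> S" and N: "N \<in> null_sets lebesgue"
  obtains s t where "p < s" "s < t" "t < q" "s \<notin> N" "t \<notin> N" "average {s..t} f \<in> S"
proof -
  define G where "G x = integral {a..x} f" for x
  have Gc: "continuous_on {a..b} G" unfolding G_def
    by (intro indefinite_integral_continuous_1 set_lebesgue_integral_eq_integral(1)[OF f])
  have avg: "average {s..t} f = (1 / (t - s)) *\<^sub>R (G t - G s)" if "a \<le> s" "s < t" "t \<le> b" for s t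
    unfolding G_def using that by (intro average_eq_integral[OF f]) (auto simp: subset_eq)
  have "((\<lambda>t. (1 / (t - p)) *\<^sub>R (G t - G p)) \<longlongrightarrow> (1 / (q - p)) *\<^sub>R (G q - G p)) (at q within {p..q})"
  proof (intro tendsto_intros)
    have "continuous_on {p..q} G" using Gc pq by (auto elim: continuous_on_subset)
    then show "(G \<longlongrightarrow> G q) (at q within {p..q})" using pq by (simp add: continuous_on_def)
  qed (use pq in auto)
  then have "\<forall>\<^sub>F t in at q within {p..q}. (1 / (t - p)) *\<^sub>R (G t - G p) \<in> S"
    using S avg[of p q] pq by (auto dest: topological_tendstoD)
  then have "\<forall>\<^sub>F t in at_left q. (1 / (t - p)) *\<^sub>R (G t - G p) \<in> S"
    using pq by (simp add: at_within_Icc_at_left)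
  then obtain c where c: "c < q" "\<And>t. c < t \<Longrightarrow> t < q \<Longrightarrow> (1 / (t - p)) *\<^sub>R (G t - G p) \<in> S"
    unfolding eventually_at_left_field by blast
  obtain t where t: "max c p < t" "t < q" "t \<notin> N"
    using interval_diff_null_nonempty[OF _ N, of "max c p" q] c pq by auto
  have "((\<lambda>s. (1 / (t - s)) *\<^sub>R (G t - G s)) \<longlongrightarrow> (1 / (t - p)) *\<^sub>R (G t - G p)) (at p within {p..t})"
  proof (intro tendsto_intros)
    have "continuous_on {p..t} G" using Gc pq t by (auto elim: continuous_on_subset)
    then show "(G \<longlongrightarrow> G p) (at p within {p..t})" using t by (simp add: continuous_on_def)
  qed (use t in auto)
  then have "\<forall>\<^sub>F s in at p within {p..t}. (1 / (t - s)) *\<^sub>R (G t - G s) \<in> S"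
    using S c(2)[of t] t by (auto dest: topological_tendstoD)
  then have "\<forall>\<^sub>F s in at_right p. (1 / (t - s)) *\<^sub>R (G t - G s) \<in> S"
    using t by (simp add: at_within_Icc_at_right)
  then obtain d where d: "p < d" "\<And>s. p < s \<Longrightarrow> s < d \<Longrightarrow> (1 / (t - s)) *\<^sub>R (G t - G s) \<in> S"
    unfolding eventually_at_right_field by blast
  obtain s where s: "p < s" "s < min d t" "s \<notin> N"
    using interval_diff_null_nonempty[OF _ N, of p "min d t"] d t by auto
  have "average {s..t} f \<in> S" using avg[of s t] d(2)[of s] s t pq by auto
  then show thesis using that[of s t] s t by auto
qed

theorem corollary3p12:
  fixes I :: "real set" and \<Omega>0 \<Omega>1 :: "(real^2) set" and p u :: "real^2"
    and \<phi> :: "real \<Rightarrow> real^2"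
  assumes "bounded_interval I"
    and "\<Omega>0 \<noteq> {}" and "open \<Omega>0" and "convex \<Omega>0" and "\<not> contains_line \<Omega>0"
    and "open \<Omega>1" and "convex \<Omega>1" and "closure \<Omega>1 \<subseteq> \<Omega>0"
    and "\<not> contains_segment (frontier \<Omega>0)" and "\<not> contains_segment (frontier \<Omega>1)"
    and "\<not> bounded \<Omega>0"
    and "\<forall>x d. d \<noteq> 0 \<and> ray x d \<subseteq> \<Omega>0 \<longrightarrow> (\<exists>v. (+) v ` ray x d \<subseteq> \<Omega>1)"
    and "norm u = 1" and "inj_on (proj_line p u) (frontier \<Omega>0)"
    and "\<phi> \<in> A_class I \<Omega>0 \<Omega>1"
  shows "(\<exists>\<psi>. nondecreasing_rearrangement I \<Omega>0 p u \<phi> \<psi>) \<and>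
    (\<forall>\<psi>. nondecreasing_rearrangement I \<Omega>0 p u \<phi> \<psi> \<longrightarrow> \<psi> \<in> A_class I \<Omega>0 \<Omega>1)"
proof -
  define a b where "a = Inf I" and "b = Sup I"
  have "I \<noteq> {}" using assms(1) by (auto simp: bounded_interval_def)
  then have I: "{a<..<b} \<subseteq> I" "I \<subseteq> {a..b}"
    using assms(1) is_interval_Inf_Sup[of I] by (auto simp: a_def b_def bounded_interval_def)
  have ab: "a < b"
  proof (rule ccontr)
    assume "\<not> a < b"
    then have "interior {a..b} = {}" by (simp add: interior_atLeastAtMost_real)
    then show False using assms(1) interior_mono[OF I(2)] by (auto simp: bounded_interval_def)
  qed
  have mI: "I \<in> sets lebesgue" by (rule sets_lebesgue_between[OF I])
  have bdI: "I \<in> lmeasurable"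
    by (rule bounded_set_imp_lmeasurable[OF bounded_subset[OF bounded_closed_interval I(2)] mI])
  have fin: "finite_measure (lebesgue_on I)" using bdI by (rule finite_measure_lebesgue_on)
  have \<phi>I: "\<phi> absolutely_integrable_on I" and \<phi>\<Gamma>: "\<phi> ` I \<subseteq> frontier \<Omega>0"
    using assms(15) by (auto simp: A_class_def)
  have \<phi>m: "\<phi> \<in> borel_measurable (lebesgue_on I)"
    using \<phi>I mI by (rule absolutely_integrable_imp_borel_measurable)
  have inj: "inj_on (\<lambda>w. w \<bullet> u) (frontier \<Omega>0)"
    using assms(14) by (auto simp: inj_on_def proj_line_def inner_diff_left)
  have injm: "inj_on (\<lambda>w. w \<bullet> (- u)) (frontier \<Omega>0)" using inj by (auto simp: inj_on_def)
  \<comment> \<open>\<open>u\<close> rotated by a quarter turn; which sign points upward is decided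
    below.\<close>
  define e0 :: "real^2" where "e0 = vector [- (u $ 2), u $ 1]"
  have e0u: "e0 \<bullet> u = 0" and "norm e0 = norm u"
    by (simp_all add: e0_def inner_vec_def sum_2 norm_vec_def L2_set_def add.commute)
  then have ne0: "norm e0 = 1" using assms(13) by simp
  then have e00: "e0 \<noteq> 0" by auto
  have "\<exists>t. x + t *\<^sub>R e0 \<notin> \<Omega>0" for x
    using assms(5) e00 unfolding contains_line_def line_def by blast
  then obtain e where e: "e = e0 \<or> e = - e0" and up0: "\<And>z t. z \<in> \<Omega>0 \<Longrightarrow> t \<ge> 0 \<Longrightarrow> z + t *\<^sub>R e \<in> \<Omega>0"
    and down: "\<And>z. z \<in> \<Omega>0 \<Longrightarrow> \<exists>t>0. z - t *\<^sub>R e \<in> frontier \<Omega>0"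
    using epigraph_direction[OF assms(2-4) _ inj e0u] by blast
  have ne: "norm e = 1" and eu: "e \<bullet> u = 0" and e0: "e \<noteq> 0" using e ne0 e0u e00 by auto
  obtain z0 where "z0 \<in> \<Omega>0" using assms(2) by blast
  \<comment> \<open>The hypothesis on rays moves this upward ray into \<Omega>1, and one such ray
    makes the open convex set \<Omega>1 closed under upward translation.\<close>
  then have "ray z0 e \<subseteq> \<Omega>0" using up0 by (auto simp: ray_def)
  then obtain v where v: "(+) v ` ray z0 e \<subseteq> \<Omega>1" using assms(12) e0 by blast
  have vt: "(v + z0) + t *\<^sub>R e \<in> \<Omega>1" if "t \<ge> 0" for t
  proof -
    have "z0 + t *\<^sub>R e \<in> ray z0 e" using that by (auto simp: ray_def)
    then have "v + (z0 + t *\<^sub>R e) \<in> \<Omega>1" using v by blast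
    then show ?thesis by (simp add: add.assoc)
  qed
  have up1: "w + t *\<^sub>R e \<in> \<Omega>1" if "w \<in> \<Omega>1" "t \<ge> 0" for w t
    by (rule open_convex_add_recession[OF assms(6,7) _ that]) (rule vt)
  have supp: "\<exists>\<sigma>. \<forall>z \<in> frontier \<Omega>0. z \<bullet> e \<ge> w \<bullet> e + \<sigma> * (z \<bullet> u - w \<bullet> u)"
    if "w \<in> frontier \<Omega>0" for w
    by (rule frontier_support[OF assms(2-4) inj assms(13) ne eu _ that]) (rule up0)
  \<comment> \<open>Reversing \<open>u\<close> merely changes the sign of the slope.\<close>
  have suppm: "\<exists>\<sigma>. \<forall>z \<in> frontier \<Omega>0. z \<bullet> e \<ge> w \<bullet> e + \<sigma> * (z \<bullet> (- u) - w \<bullet> (- u))"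
    if w: "w \<in> frontier \<Omega>0" for w
  proof -
    obtain \<sigma> where "\<forall>z \<in> frontier \<Omega>0. z \<bullet> e \<ge> w \<bullet> e + \<sigma> * (z \<bullet> u - w \<bullet> u)"
      using supp[OF w] by blast
    then show ?thesis by (intro exI[of _ "- \<sigma>"]) (simp add: algebra_simps)
  qed
  have "\<psi> \<in> A_class I \<Omega>0 \<Omega>1" if rearr: "nondecreasing_rearrangement I \<Omega>0 p u \<phi> \<psi>" for \<psi>
  proof -
    obtain N where \<psi>\<Gamma>: "\<psi> ` I \<subseteq> frontier \<Omega>0" and \<psi>m: "\<psi> \<in> borel_measurable (lebesgue_on I)"
      and eqP: "distr (uniform_measure (lebesgue_on I) I) borel \<phi> =
        distr (uniform_measure (lebesgue_on I) I) borel \<psi>"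
      and N: "N \<in> null_sets lebesgue" and mono: "nondecreasing_on p u (I - N) \<psi>"
      using rearr by (auto simp: nondecreasing_rearrangement_def equimeasurable_def)
    have eq: "distr (lebesgue_on I) borel \<phi> = distr (lebesgue_on I) borel \<psi>"
    proof (rule distr_eq_of_uniform_measure[OF fin _ \<phi>m \<psi>m])
      have "emeasure lebesgue {a<..<b} \<le> emeasure lebesgue I" by (rule emeasure_mono[OF I(1) mI])
      then show "emeasure (lebesgue_on I) (space (lebesgue_on I)) \<noteq> 0"
        using ab mI by (auto simp: emeasure_restrict_space space_restrict_space)
    qed (use eqP in \<open>simp add: space_restrict_space\<close>)
    have \<psi>I: "\<psi> absolutely_integrable_on I"
    proof -
      have "integrable (lebesgue_on I) (\<lambda>t. norm (\<phi> t))"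
        using \<phi>I mI by (intro integrable_norm) (simp add: integrable_restrict_space set_integrable_def)
      then have "integrable (lebesgue_on I) (\<lambda>t. norm (\<psi> t))"
        using integrable_equidistributed(1)[OF \<phi>m \<psi>m eq, of norm] by simp
      then have "integrable (lebesgue_on I) \<psi>" using \<psi>m by (simp add: integrable_norm_iff)
      then show ?thesis using mI by (simp add: integrable_restrict_space set_integrable_def)
    qed
    have \<psi>ab: "\<psi> absolutely_integrable_on {a..b}"
      by (rule absolutely_integrable_between[OF \<psi>I I])
    have "average J \<psi> \<notin> \<Omega>1" if J: "bounded_interval J" "J \<subseteq> I" for J
    proof
      assume avg: "average J \<psi> \<in> \<Omega>1"
      define q r where "q = Inf J" and "r = Sup J"
      have "J \<noteq> {}" using J by (auto simp: bounded_interval_def)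
      then have qr: "{q<..<r} \<subseteq> J" "J \<subseteq> {q..r}"
        using J is_interval_Inf_Sup[of J] by (auto simp: q_def r_def bounded_interval_def)
      have "q < r"
      proof (rule ccontr)
        assume "\<not> q < r"
        then have "interior {q..r} = {}" by (simp add: interior_atLeastAtMost_real)
        then show False using J interior_mono[OF qr(2)] by (auto simp: bounded_interval_def)
      qed
      have "a \<le> q" "r \<le> b"
      proof -
        have "J \<subseteq> {a..b}" using J(2) I(2) by blast
        then show "a \<le> q" "r \<le> b"
          using \<open>J \<noteq> {}\<close> unfolding q_def r_def
          by (auto intro!: cInf_greatest cSup_least simp: subset_eq)
      qed
      note qrb = \<open>a \<le> q\<close> \<open>q < r\<close> \<open>r \<le> b\<close>
      have "average {q..r} \<psi> \<in> \<Omega>1"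
        using avg average_eq_integral(2)[OF \<psi>ab qrb qr] average_eq_integral(2)[OF \<psi>ab qrb, of "{q..r}"]
        by (simp add: greaterThanLessThan_subseteq_atLeastAtMost_iff)
      \<comment> \<open>Since \<open>s\<close> and \<open>t\<close> avoid \<open>N\<close>,
        monotonicity makes \<open>\<psi> s\<close> and \<open>\<psi> t\<close> the ends
        \<open>C\<close> and \<open>D\<close> of the window of values.\<close>
      then obtain s t where st: "q < s" "s < t" "t < r" "s \<notin> N" "t \<notin> N" "average {s..t} \<psi> \<in> \<Omega>1"
        using shrink_interval[OF \<psi>ab qrb assms(6) _ N] by blast
      define z where "z = average {s..t} \<psi>"
      have stI: "{s..t} \<subseteq> I" using I(1) st qrb by (auto simp: subset_eq)
      then have sI: "s \<in> I - N" "t \<in> I - N" using st by auto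
      have "z \<in> \<Omega>0" using st(6) assms(8) closure_subset unfolding z_def by blast
      \<comment> \<open>The frontier point straight below \<open>z\<close> serves as
        \<open>A\<close>.\<close>
      then obtain \<tau> where \<tau>: "\<tau> > 0" "z - \<tau> *\<^sub>R e \<in> frontier \<Omega>0" using down by blast
      have A: "(z - \<tau> *\<^sub>R e) \<bullet> u = z \<bullet> u" "(z - \<tau> *\<^sub>R e) \<bullet> e < z \<bullet> e"
        using \<tau> eu ne by (simp_all add: inner_diff_left norm_eq_1)
      then have Am: "(z - \<tau> *\<^sub>R e) \<bullet> (- u) = z \<bullet> (- u)" by simp
      have mst: "measure lebesgue {s..t} = t - s" using st by simp
      have zint: "(LINT t:{s..t}|lebesgue. \<psi> t) = measure lebesgue {s..t} *\<^sub>R z"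
        using st unfolding z_def average_def mst by simp
      have "AE x in lebesgue. x \<notin> N" using N by (rule AE_not_in)
      then have AEN: "AE x in lebesgue_on I. x \<notin> N \<and> x \<in> I"
        using mI by (auto simp: AE_restrict_space_iff elim!: eventually_mono)
      have m: "\<psi> x \<bullet> u \<le> \<psi> y \<bullet> u" if "x \<in> I - N" "y \<in> I - N" "x \<le> y" for x y
        using mono that by (auto simp: nondecreasing_on_def mono_on_def proj_line_def inner_diff_left)
      have w1: "AE x in lebesgue_on I. x \<in> {s..t} \<longrightarrow> \<psi> s \<bullet> u \<le> \<psi> x \<bullet> u \<and> \<psi> x \<bullet> u \<le> \<psi> t \<bullet> u"
        using AEN by eventually_elim (use m sI in auto)
      have w2: "AE x in lebesgue_on I. x \<notin> {s..t} \<longrightarrow> \<psi> x \<bullet> u \<le> \<psi> s \<bullet> u \<or> \<psi> t \<bullet> u \<le> \<psi> x \<bullet> u"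
        using AEN
      proof eventually_elim
        case (elim x)
        then show ?case using m[of x s] m[of t x] sI by (cases "x \<le> s") auto
      qed
      have st\<Gamma>: "\<psi> s \<in> frontier \<Omega>0" "\<psi> t \<in> frontier \<Omega>0" using sI \<psi>\<Gamma> by auto
      have mst0: "measure lebesgue {s..t} > 0" using st mst by simp
      have "z \<notin> \<Omega>1"
      \<comment> \<open>If the mean of \<open>\<phi> \<bullet> u\<close> exceeds
        \<open>z \<bullet> u\<close>, the picture is reflected by passing to \<open>- u\<close>;
        then \<open>\<psi> t\<close> becomes the lower and \<open>\<psi> s\<close> the upper end of
        the window.\<close>
      proof (cases "(LINT x:I|lebesgue. \<phi> x \<bullet> u) \<le> (b - a) * (z \<bullet> u)")
        case True
        show ?thesis
          by (rule window_average_avoids[OF ab I assms(15) \<psi>I \<psi>\<Gamma> eq supp inj assms(13) ne eu up1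
              assms(6) \<tau>(2) A _ stI mst0 zint st\<Gamma> w1 w2 True]) simp_all
      next
        case False
        have "(LINT x:I|lebesgue. \<phi> x \<bullet> (- u)) \<le> (b - a) * (z \<bullet> (- u))"
          using False by (simp add: set_lebesgue_integral_def)
        moreover have "AE x in lebesgue_on I. x \<in> {s..t} \<longrightarrow>
            \<psi> t \<bullet> (- u) \<le> \<psi> x \<bullet> (- u) \<and> \<psi> x \<bullet> (- u) \<le> \<psi> s \<bullet> (- u)"
          using w1 by eventually_elim auto
        moreover have "AE x in lebesgue_on I. x \<notin> {s..t} \<longrightarrow>
            \<psi> x \<bullet> (- u) \<le> \<psi> t \<bullet> (- u) \<or> \<psi> s \<bullet> (- u) \<le> \<psi> x \<bullet> (- u)"
          using w2 by eventually_elim auto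
        moreover have "norm (- u) = 1" "e \<bullet> (- u) = 0" using assms(13) eu by auto
        ultimately show ?thesis
          by (intro window_average_avoids[OF ab I assms(15) \<psi>I \<psi>\<Gamma> eq suppm injm _ ne _ up1
              assms(6) \<tau>(2) Am A(2) _ stI mst0 zint st\<Gamma>(2,1)]) simp_all
      qed
      then show False using st(6) by (simp add: z_def)
    qed
    then show ?thesis using \<psi>I \<psi>\<Gamma> by (simp add: A_class_def)
  qed
  then show ?thesis
    using exists_nondecreasing_rearrangement[OF ab I \<phi>m \<phi>\<Gamma> inj] by blast
qed

end
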